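(* Assume that $V$ satisfies (A1)--(A2) (stated in the context). Let $A\subset\Omega$ be a Lipschitz subdomain whose closure is not $V$-invariant. Assume that $$d\big(A,\{T=0,+\infty\}\big)>0\quad\text{and}\quad\inf_{x\in A}|\nabla T(x)|>0.$$ Then there exist two constants $C_1,C_2>0$ such that $$C_1(1+t)^{-1}\le \mathrm{MixingScale}(t,A)\le C_2(1+t)^{-1},\qquad t\ge0.$$
   Context: $\Omega\subset\mathbb R^2$ is a bounded Lipschitz domain (open, connected) and $V\in C^1(\overline\Omega;\mathbb R^2)$ (meaning $V$ is $C^1$ on some open set containing $\overline\Omega$) is a time-independent vector field with $\operatorname{div}V=0$ in $\Omega$ and $V\cdot\vec n=0$ on $\partial\Omega$ ($\vec n$ the outward unit normal). Assumptions: (A1) There is $H\in C^2(\mathbb R^2)$ with $V=(\partial_2H,-\partial_1H)^\top$ in $\overline\Omega$ and $H=0$ on $\partial\Omega$. (A2) $H$ has finitely many critical points $x_1^*,\dots,x_K^*$ on $\overline\Omega$, and for each $k$ there are a real number $m_k\ge1$ and a symmetric nonsingular $S_k\in\mathbb R^{2\times2}$ such that $H(x_k^*+y)-H(x_k^* )=\frac12|y|^{m_k-1}y^\top S_ky+R_k(y)$ for $y$ near $0$, where $R_k\in C^2(\mathbb R^2)$ and $\|D^jR_k(y)\|=o(|y|^{m_k+1-j})$ as $y\to0$, $j=0,1,2$. Flow: for $x_0\in\overline\Omega$, $x(\cdot;x_0)$ solves $x'(t)=V(x(t))$, $t\in\mathbb R$, $x(0)=x_0$, and $\Phi(t)(x_0):=x(t;x_0)$.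 Orbit period: $T(x_0):=\inf\{\hat t>0: x(\hat t;x_0)=x_0\}\in[0,+\infty]$ for $x_0\in\overline\Omega$, with $T(x_0)=+\infty$ if the set is empty. $T$ is $C^1$ on the set $\{0<T<+\infty\}$, so $\nabla T$ makes sense there. $\{T=0,+\infty\}$ is the set of points where $T$ is $0$ or $+\infty$. $d(\cdot,\cdot)$ is the Euclidean distance (between points and/or sets), equal to $+\infty$ by convention if one of the sets is empty. Orbits: for $E\subset\overline\Omega$, $\mathrm{Orbit}(E):=\bigcup_{t\in\mathbb R}\Phi(t)(E)$; $E$ is called $V$-invariant if $\mathrm{Orbit}(E)=E$. Mixing scale: for nonempty open sets $E\subset F\subset\mathbb R^2$, $E$ is mixed to scale $\varepsilon>0$ over $F$ if there exists $\kappa>0$ such that $|B_\varepsilon(x)\cap E|\ge\kappa|B_\varepsilon(x)|$ for each $x\in F$ ($|\cdot|$ Lebesgue measure, $B_\varepsilon(x)$ open ball). For a nonempty open $A\subset\Omega$ and $t\ge0$, $V$ mixes $A$ to scale $\varepsilon$ at time $t$ if $\Phi(t)(A)$ is mixed to scale $\varepsilon$ over $\mathrm{Orbit}(A)$, and $\mathrm{MixingScale}(t,A)$ is the infimum of all such $\varepsilon>0$. *)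

theory Defs
  imports "HOL-Analysis.Analysis" "HOL-Library.Landau_Symbols"
begin
definition C1_on :: "('a::real_normed_vector \<Rightarrow> 'b::real_normed_vector) \<Rightarrow> 'a set \<Rightarrow> bool" where
  "C1_on f U \<longleftrightarrow> (\<exists>f' :: 'a \<Rightarrow> 'a \<Rightarrow>\<^sub>L 'b.
     (\<forall>x\<in>U. (f has_derivative blinfun_apply (f' x)) (at x)) \<and> continuous_on U f')"

text \<open>
  \<open>f\<close> is of class \<open>C\<^sup>2\<close> on the whole space, with first and second derivatives \<open>f'\<close> and \<open>f''\<close>;
  the norms of \<open>f' x\<close> and \<open>f'' x\<close> are then operator norms.
\<close>
definition C2_with ::
  "('a::real_normed_vector \<Rightarrow> 'b::real_normed_vector) \<Rightarrow> ('a \<Rightarrow> 'a \<Rightarrow>\<^sub>L 'b) \<Rightarrow>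
   ('a \<Rightarrow> 'a \<Rightarrow>\<^sub>L ('a \<Rightarrow>\<^sub>L 'b)) \<Rightarrow> bool" where
  "C2_with f f' f'' \<longleftrightarrow>
     (\<forall>x. (f has_derivative blinfun_apply (f' x)) (at x)) \<and>
     (\<forall>x. (f' has_derivative blinfun_apply (f'' x)) (at x)) \<and>
     continuous_on UNIV f''"

definition C2 :: "('a::real_normed_vector \<Rightarrow> 'b::real_normed_vector) \<Rightarrow> bool" where
  "C2 f \<longleftrightarrow> (\<exists>f' f''. C2_with f f' f'')"

definition partial_deriv :: "'n \<Rightarrow> (real^'n \<Rightarrow> 'b::real_normed_vector) \<Rightarrow> real^'n \<Rightarrow> 'b" where
  "partial_deriv i f x = frechet_derivative f (at x) (axis i 1)"

definition grad :: "(real^'n \<Rightarrow> real) \<Rightarrow> real^'n \<Rightarrow> real^'n" where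
  "grad f x = (\<chi> i. partial_deriv i f x)"

definition divergence :: "(real^'n \<Rightarrow> real^'n) \<Rightarrow> real^'n \<Rightarrow> real" where
  "divergence W x = (\<Sum>i\<in>UNIV. partial_deriv i W x $ i)"

text \<open>
  In the orthonormal coordinates given by \<open>Q\<close>, the set \<open>D\<close> coincides near \<open>p\<close> with the
  strict epigraph of the Lipschitz function \<open>\<gamma>\<close>.
\<close>
definition lipschitz_chart ::
  "(real^2) set \<Rightarrow> real^2 \<Rightarrow> real \<Rightarrow> (real^2 \<Rightarrow> real^2) \<Rightarrow> (real \<Rightarrow> real) \<Rightarrow> bool" where
  "lipschitz_chart D p r Q \<gamma> \<longleftrightarrow>
     0 < r \<and> orthogonal_transformation Q \<and> (\<exists>L. L-lipschitz_on UNIV \<gamma>) \<and>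
     D \<inter> ball p r = {x \<in> ball p r. \<gamma> (Q x $ 1) < Q x $ 2}"

definition bounded_lipschitz_domain :: "(real^2) set \<Rightarrow> bool" where
  "bounded_lipschitz_domain D \<longleftrightarrow>
     D \<noteq> {} \<and> open D \<and> connected D \<and> bounded D \<and>
     (\<forall>p\<in>frontier D. \<exists>r Q \<gamma>. lipschitz_chart D p r Q \<gamma>)"

text \<open>
  The normal exists at those boundary points where the local graph function is differentiable
  (almost all of them, by Rademacher's theorem). As \<open>D\<close> lies above the graph, the outward
  direction is the downward one \<open>(\<gamma>', -1)\<close> in the coordinates given by \<open>Q\<close>.
\<close>
definition outward_unit_normal :: "(real^2) set \<Rightarrow> real^2 \<Rightarrow> real^2 \<Rightarrow> bool" where
  "outward_unit_normal D p n \<longleftrightarrow>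
     p \<in> frontier D \<and>
     (\<exists>r Q \<gamma> a. lipschitz_chart D p r Q \<gamma> \<and>
        (\<gamma> has_real_derivative a) (at (Q p $ 1)) \<and>
        Q n = (1 / sqrt (1 + a\<^sup>2)) *\<^sub>R vector [a, -1])"

definition admissible_field :: "(real^2) set \<Rightarrow> (real^2 \<Rightarrow> real^2) \<Rightarrow> bool" where
  "admissible_field \<Omega> V \<longleftrightarrow>
     (\<exists>U. open U \<and> closure \<Omega> \<subseteq> U \<and> C1_on V U) \<and>
     (\<forall>x\<in>\<Omega>. divergence V x = 0) \<and>
     (\<forall>x n. outward_unit_normal \<Omega> x n \<longrightarrow> V x \<bullet> n = 0)"

definition stream_function :: "(real^2) set \<Rightarrow> (real^2 \<Rightarrow> real^2) \<Rightarrow> (real^2 \<Rightarrow> real) \<Rightarrow> bool" where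
  "stream_function \<Omega> V H \<longleftrightarrow>
     C2 H \<and>
     (\<forall>x\<in>closure \<Omega>. V x = vector [partial_deriv 2 H x, - partial_deriv 1 H x]) \<and>
     (\<forall>x\<in>frontier \<Omega>. H x = 0)"

definition critical_points :: "(real^2) set \<Rightarrow> (real^2 \<Rightarrow> real) \<Rightarrow> (real^2) set" where
  "critical_points \<Omega> H = {x \<in> closure \<Omega>. grad H x = 0}"

text \<open>
  The filter \<open>at 0\<close> omits \<open>y = 0\<close>, so the convention \<open>0 powr 0 = 0\<close> does not
  matter in the Landau symbols; in the expansion of \<open>H\<close> the factor \<open>y \<bullet> (S *v y)\<close> vanishes
  at \<open>y = 0\<close> anyway.
\<close>
definition homogeneous_critical_points :: "(real^2) set \<Rightarrow> (real^2 \<Rightarrow> real) \<Rightarrow> bool" where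
  "homogeneous_critical_points \<Omega> H \<longleftrightarrow>
     finite (critical_points \<Omega> H) \<and>
     (\<forall>p\<in>critical_points \<Omega> H. \<exists>(m::real) (S::real^2^2) R R' R''.
        1 \<le> m \<and> transpose S = S \<and> invertible S \<and>
        (\<forall>\<^sub>F y in nhds 0.
           H (p + y) - H p = 1/2 * norm y powr (m - 1) * (y \<bullet> (S *v y)) + R y) \<and>
        C2_with R R' R'' \<and>
        (\<lambda>y. norm (R y)) \<in> o[at 0](\<lambda>y. norm y powr (m + 1)) \<and>
        (\<lambda>y. norm (R' y)) \<in> o[at 0](\<lambda>y. norm y powr m) \<and>
        (\<lambda>y. norm (R'' y)) \<in> o[at 0](\<lambda>y. norm y powr (m - 1)))"

text \<open>\<open>\<Phi> t x\<close> is the position at time \<open>t\<close> of the particle starting at \<open>x \<in> K\<close>; only the values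
  of \<open>V\<close> on \<open>K\<close> matter, and the values of \<open>\<Phi> t\<close> outside \<open>K\<close> are irrelevant.\<close>
definition is_flow :: "(real^2 \<Rightarrow> real^2) \<Rightarrow> (real^2) set \<Rightarrow> (real \<Rightarrow> real^2 \<Rightarrow> real^2) \<Rightarrow> bool" where
  "is_flow V K \<Phi> \<longleftrightarrow>
     (\<forall>x\<in>K. \<Phi> 0 x = x \<and>
        (\<forall>t. \<Phi> t x \<in> K \<and> ((\<lambda>s. \<Phi> s x) has_vector_derivative V (\<Phi> t x)) (at t)))"

definition orbit :: "(real \<Rightarrow> 'a \<Rightarrow> 'a) \<Rightarrow> 'a set \<Rightarrow> 'a set" where
  "orbit \<Phi> E = (\<Union>t. \<Phi> t ` E)"

definition flow_invariant :: "(real \<Rightarrow> 'a \<Rightarrow> 'a) \<Rightarrow> 'a set \<Rightarrow> bool" where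
  "flow_invariant \<Phi> E \<longleftrightarrow> orbit \<Phi> E = E"

definition orbit_period :: "(real \<Rightarrow> 'a \<Rightarrow> 'a) \<Rightarrow> 'a \<Rightarrow> ereal" where
  "orbit_period \<Phi> x = Inf (ereal ` {t. 0 < t \<and> \<Phi> t x = x})"

definition degenerate_period_set :: "(real^2) set \<Rightarrow> (real \<Rightarrow> real^2 \<Rightarrow> real^2) \<Rightarrow> (real^2) set" where
  "degenerate_period_set \<Omega> \<Phi> =
     {x \<in> closure \<Omega>. orbit_period \<Phi> x = 0 \<or> orbit_period \<Phi> x = \<infinity>}"

text \<open>Unlike \<^const>\<open>setdist\<close>, this is \<open>\<infinity>\<close> if one of the sets is empty.\<close>
definition set_distance :: "'a::metric_space set \<Rightarrow> 'a set \<Rightarrow> ereal" where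
  "set_distance A B = (INF x\<in>A. INF y\<in>B. ereal (dist x y))"

definition mixed_to_scale :: "(real^2) set \<Rightarrow> (real^2) set \<Rightarrow> real \<Rightarrow> bool" where
  "mixed_to_scale E F \<epsilon> \<longleftrightarrow>
     (\<exists>\<kappa>>0. \<forall>x\<in>F. measure lebesgue (ball x \<epsilon> \<inter> E) \<ge> \<kappa> * measure lebesgue (ball x \<epsilon>))"

definition mixing_scale :: "(real \<Rightarrow> real^2 \<Rightarrow> real^2) \<Rightarrow> real \<Rightarrow> (real^2) set \<Rightarrow> ereal" where
  "mixing_scale \<Phi> t A =
     Inf (ereal ` {\<epsilon>. 0 < \<epsilon> \<and> mixed_to_scale (\<Phi> t ` A) (orbit \<Phi> A) \<epsilon>})"

end

(*
  As kappa may depend on t, the mixing scale is comparable to the supremum of d(x, Phi_t(A)) over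
  x in Orbit(A).

  Near a periodic orbit H is conserved and injective on a transversal line, so all orbits
  through it close up, and the period T is locally a function of H. T is Frechet differentiable,
  because the flow has directional derivatives, and its gradient is parallel to that of H.

  Lower bound: let z be in Orbit(A) but not in the closure of A. If Phi_t(a) is close to Phi_t(z),
  then w = Phi_{n T(z)}(a), n the number of turns, is close to z, and
  a = Phi_{n (T(w) - T(z))}(w) is within O(1 + t) |w - z| of z; hence a is outside A unless
  |w - z| is at least of order 1/(1 + t).

  Upper bound: let x = Phi_s(a). On a segment in A of length O(1/t) issuing from a and transversal
  to the orbit, T changes by so much that (t - s)/T takes an integer value, say at b; then
  Phi_t(b) = Phi_s(b) is within O(1/t) of x.
*)
theory Submission
  imports Defs
begin

text \<open>\<open>grad\<close> is built on \<open>frechet_derivative\<close>, which carries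
  information only where the derivative exists. The hypothesis on \<nabla>T therefore becomes usable
  only after T has been shown differentiable at the points of A, and this costs the most work. Here
  H serves as the coordinate across the orbits: it is not changed by following the flow, and its
  first-order expansion replaces a derivative of the map that slides points onto the transversal.
  The flow is known on K = closure \<Omega> only, and the closure of A may touch the frontier of
  \<Omega>. Bounds by compactness are taken over the closure of A, so limits are relative to K;
  interior points of K enter only where a derivative is formed. One shear drives both bounds: orbits
  at distance \<delta> have periods differing by O(\<delta>), so after about t turns they are O(t
  \<delta>) apart. The lower bound limits this drift and needs it near a single point z. The upper
  bound needs a drift of at least this order, uniformly over A; this comes from the bound on
  \<nabla>T together with an interior cone, which supplies segments across the orbits.\<close>

section \<open>Quarter turns of the plane and Gronwall's inequality\<close>

definition rot90 :: "real^2 \<Rightarrow> real^2" where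
  "rot90 v = vector [- (v $ 2), v $ 1]"

lemma inner_2: "(u::real^2) \<bullet> v = u $ 1 * v $ 1 + u $ 2 * v $ 2"
  by (simp add: inner_vec_def sum_2)

lemma inner_rot90_self [simp]: "v \<bullet> rot90 v = 0" "rot90 v \<bullet> v = 0"
  by (simp_all add: rot90_def inner_2 algebra_simps)

lemma rot90_inner_rot90 [simp]: "rot90 u \<bullet> rot90 v = u \<bullet> v"
  by (simp add: rot90_def inner_2 algebra_simps)

lemma norm_rot90 [simp]: "norm (rot90 v) = norm v"
  by (simp add: norm_eq_sqrt_inner)

lemma rot90_diff: "rot90 u - rot90 v = rot90 (u - v)"
  by (simp add: rot90_def vec_eq_iff forall_2)

text \<open>Expansion in the orthogonal frame \<open>v\<close>, \<open>rot90 v\<close>, with the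
  factor |v|^2 cleared so that \<open>v = 0\<close> is no special case.\<close>

lemma rot90_decomposition:
  "(v \<bullet> v) *\<^sub>R u = (u \<bullet> v) *\<^sub>R v + (u \<bullet> rot90 v) *\<^sub>R rot90 v"
  by (simp add: rot90_def inner_2 vec_eq_iff forall_2 algebra_simps)

text \<open>Squaring avoids differentiating the norm at the origin.\<close>
lemma gronwall_norm:
  fixes z :: "real \<Rightarrow> 'a::real_inner"
  assumes "0 \<le> t" "0 \<le> L" "0 \<le> e"
    and deriv: "\<And>s. \<lbrakk>0 \<le> s; s \<le> t\<rbrakk> \<Longrightarrow> (z has_vector_derivative z' s) (at s)"
    and bound: "\<And>s. \<lbrakk>0 \<le> s; s \<le> t\<rbrakk> \<Longrightarrow> norm (z' s) \<le> L * norm (z s) + e"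
  shows "norm (z t) \<le> (norm (z 0) + e) * exp ((2 * L + 1) * t)"
proof -
  define c where "c = 2 * L + 1"
  have c: "1 \<le> c" using assms by (simp add: c_def)
  \<comment> \<open>By 2|z|e \<le> |z|^2 + e^2 the derivative of |z|^2 is at most c |z|^2 + e^2. The
    shift \<open>e\<^sup>2 / c\<close> makes this inequality homogeneous, so the exponential weight
    turns it into monotonicity.\<close>
  define u where "u s = (z s \<bullet> z s + e\<^sup>2 / c) * exp (- c * s)" for s
  have "u t \<le> u 0"
  proof (rule DERIV_nonpos_imp_nonincreasing[OF \<open>0 \<le> t\<close>])
    fix s assume s: "0 \<le> s" "s \<le> t"
    have dz: "((\<lambda>s. z s \<bullet> z s) has_real_derivative 2 * (z s \<bullet> z' s)) (at s)"
      using has_derivative_inner[OF deriv[OF s, unfolded has_vector_derivative_def]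
          deriv[OF s, unfolded has_vector_derivative_def]]
      unfolding has_field_derivative_def by (simp add: inner_commute algebra_simps mult_commute_abs)
    have du: "(u has_real_derivative
        (2 * (z s \<bullet> z' s) - c * (z s \<bullet> z s) - e\<^sup>2) * exp (- c * s)) (at s)"
      unfolding u_def using c
      by (auto intro!: derivative_eq_intros dz simp: algebra_simps)
    have "z s \<bullet> z' s \<le> norm (z s) * norm (z' s)" by (rule norm_cauchy_schwarz)
    also have "\<dots> \<le> norm (z s) * (L * norm (z s) + e)"
      by (intro mult_left_mono bound s) simp
    finally have "2 * (z s \<bullet> z' s) \<le> 2 * L * (norm (z s))\<^sup>2 + 2 * (norm (z s) * e)"
      by (simp add: algebra_simps power2_eq_square)
    moreover have "2 * (norm (z s) * e) \<le> (norm (z s))\<^sup>2 + e\<^sup>2"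
      using sum_squares_bound[of "norm (z s)" e] by (simp add: algebra_simps)
    ultimately have "2 * (z s \<bullet> z' s) - c * (z s \<bullet> z s) - e\<^sup>2 \<le> 0"
      by (simp add: c_def power2_norm_eq_inner algebra_simps)
    then have "(2 * (z s \<bullet> z' s) - c * (z s \<bullet> z s) - e\<^sup>2) * exp (- c * s) \<le> 0"
      by (simp add: mult_nonpos_nonneg)
    then show "\<exists>y. (u has_real_derivative y) (at s) \<and> y \<le> 0" using du by blast
  qed
  then have "(z t \<bullet> z t + e\<^sup>2 / c) * exp (- c * t) * exp (c * t)
      \<le> (z 0 \<bullet> z 0 + e\<^sup>2 / c) * exp (c * t)"
    by (simp add: u_def mult_right_mono)
  then have "z t \<bullet> z t + e\<^sup>2 / c \<le> (z 0 \<bullet> z 0 + e\<^sup>2 / c) * exp (c * t)"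
    by (simp add: mult.assoc flip: exp_add)
  moreover have "0 \<le> e\<^sup>2 / c" "e\<^sup>2 / c \<le> e\<^sup>2" using c by (auto simp: divide_le_eq mult_le_cancel_left1)
  ultimately have "(norm (z t))\<^sup>2 \<le> ((norm (z 0))\<^sup>2 + e\<^sup>2) * exp (c * t)"
    by (smt (verit) mult_right_mono exp_ge_zero power2_norm_eq_inner)
  \<comment> \<open>Both factors are enlarged to squares, so that a root can be taken of the whole
    bound.\<close>
  also have "\<dots> \<le> (norm (z 0) + e)\<^sup>2 * (exp (c * t))\<^sup>2"
  proof (rule mult_mono)
    show "(norm (z 0))\<^sup>2 + e\<^sup>2 \<le> (norm (z 0) + e)\<^sup>2"
      using assms by (simp add: power2_sum)
    have "1 \<le> exp (c * t)" using c \<open>0 \<le> t\<close> by simp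
    then show "exp (c * t) \<le> (exp (c * t))\<^sup>2"
      by (simp add: power2_eq_square)
  qed auto
  finally have "(norm (z t))\<^sup>2 \<le> ((norm (z 0) + e) * exp (c * t))\<^sup>2"
    by (simp add: power_mult_distrib)
  then show ?thesis
    unfolding c_def using assms by (auto intro: power2_le_imp_le)
qed

section \<open>Hamiltonian flows on a compact set: estimates, group law, conservation of H\<close>

text \<open>\<open>H_deriv\<close> says that \<nabla>H is the quarter turn of \<open>W\<close>.
  \<open>W\<close> and \<open>H\<close> are given on the whole plane because K need not be convex,
  and segments between its points may leave it.\<close>

locale hamiltonian_flow =
  fixes K :: "(real^2) set" and H :: "real^2 \<Rightarrow> real" and W :: "real^2 \<Rightarrow> real^2"
    and DW :: "real^2 \<Rightarrow> ((real^2) \<Rightarrow>\<^sub>L (real^2))" and \<Phi> :: "real \<Rightarrow> real^2 \<Rightarrow> real^2"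
  assumes compact_K: "compact K"
    and W_deriv: "(W has_derivative blinfun_apply (DW x)) (at x)"
    and DW_cont: "continuous_on UNIV DW"
    and H_deriv: "(H has_derivative (\<lambda>w. rot90 (W x) \<bullet> w)) (at x)"
    and flow: "is_flow W K \<Phi>"
begin

text \<open>One constant for the Lipschitz bound, the derivative and the speed, so that later
  estimates carry only \<open>lip\<close>.\<close>

definition is_lip :: "real \<Rightarrow> bool" where
  "is_lip L \<longleftrightarrow> 0 < L \<and> (\<forall>x\<in>K. \<forall>y\<in>K. norm (W y - W x) \<le> L * norm (y - x)) \<and>
     (\<forall>x\<in>K. norm (DW x) \<le> L) \<and> (\<forall>x\<in>K. norm (W x) \<le> L)"

lemma continuous_W: "continuous_on S W"
  by (meson W_deriv continuous_at_imp_continuous_on has_derivative_continuous)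

text \<open>Uniform continuity of \<open>DW\<close> makes the linearization error small uniformly in
  the base point. It is used on a ball around K, which is convex and contains the segments.\<close>

lemma uniform_remainder:
  assumes "0 < e"
  obtains d where "0 < d"
    "\<And>x y. \<lbrakk>x \<in> K; y \<in> K; norm (y - x) < d\<rbrakk> \<Longrightarrow> norm (W y - W x - DW x (y - x)) \<le> e * norm (y - x)"
proof -
  obtain R where R: "K \<subseteq> cball 0 R"
    using compact_imp_bounded[OF compact_K] by (auto simp: bounded_iff subset_iff)
  have "uniformly_continuous_on (cball 0 R) DW"
    by (rule compact_uniformly_continuous[OF continuous_on_subset[OF DW_cont]]) auto
  then obtain d where d: "0 < d"
    "\<And>x y. \<lbrakk>x \<in> cball 0 R; y \<in> cball 0 R; dist y x < d\<rbrakk> \<Longrightarrow> dist (DW y) (DW x) < e"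
    using \<open>0 < e\<close> unfolding uniformly_continuous_on_def by meson
  show thesis
  proof (rule that[OF d(1)])
    fix x y assume xy: "x \<in> K" "y \<in> K" "norm (y - x) < d"
    have "norm (W y - W x - DW x (y - x)) \<le> norm (y - x) * e"
    proof (rule differentiable_bound_linearization[where S = "closed_segment x y" and f' = "\<lambda>x. blinfun_apply (DW x)"])
      show "x + t *\<^sub>R (y - x) \<in> closed_segment x y" if "t \<in> {0..1}" for t
        using that by (auto simp: in_segment algebra_simps intro!: exI[of _ t])
      show "(W has_derivative blinfun_apply (DW u)) (at u within closed_segment x y)" for u
        using W_deriv has_derivative_at_withinI by blast
      show "onorm (blinfun_apply (DW u) - blinfun_apply (DW x)) \<le> e"
        if "u \<in> closed_segment x y" for u
      proof -
        have "closed_segment x y \<subseteq> cball 0 R"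
          using R xy by (intro closed_segment_subset) auto
        then have "u \<in> cball 0 R" "x \<in> cball 0 R"
          using that R xy by auto
        moreover have "dist u x < d"
          using that xy(3) by (metis dist_commute dist_in_closed_segment dist_norm order_le_less_trans)
        ultimately have "norm (DW u - DW x) < e" using d(2) by (simp add: dist_norm)
        then show ?thesis
          by (simp add: norm_blinfun.rep_eq minus_blinfun.rep_eq fun_diff_def)
      qed
    qed auto
    then show "norm (W y - W x - DW x (y - x)) \<le> e * norm (y - x)" by (simp add: mult.commute)
  qed
qed

lemma is_lip_exists: "\<exists>L. is_lip L"
proof -
  obtain R where R: "K \<subseteq> cball 0 R"
    using compact_imp_bounded[OF compact_K] by (auto simp: bounded_iff subset_iff)
  have "compact (DW ` cball 0 R)" "compact (W ` cball 0 R)"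
    by (auto intro!: compact_continuous_image continuous_on_subset[OF DW_cont] continuous_W)
  then obtain a b where a: "\<And>x. x \<in> cball 0 R \<Longrightarrow> norm (DW x) \<le> a"
    and b: "\<And>x. x \<in> cball 0 R \<Longrightarrow> norm (W x) \<le> b"
    by (metis bounded_iff compact_imp_bounded imageI)
  define L where "L = max 1 (max a b)"
  have "norm (W y - W x) \<le> L * norm (y - x)" if "x \<in> K" "y \<in> K" for x y
  proof (rule differentiable_bound[where S = "cball 0 R" and f' = "\<lambda>x. blinfun_apply (DW x)"])
    show "(W has_derivative blinfun_apply (DW u)) (at u within cball 0 R)" for u
      using W_deriv has_derivative_at_withinI by blast
    show "onorm (blinfun_apply (DW u)) \<le> L" if "u \<in> cball 0 R" for u
      using a[OF that] by (simp add: L_def norm_blinfun.rep_eq)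
  qed (use that R in auto)
  then have "is_lip L"
    using R a b by (fastforce simp: is_lip_def L_def)
  then show ?thesis ..
qed

definition lip :: real where "lip = (SOME L. is_lip L)"

lemma is_lip_lip: "is_lip lip"
  unfolding lip_def using is_lip_exists by (rule someI_ex)

lemma lip_pos: "0 < lip"
  and W_lipschitz: "\<lbrakk>x \<in> K; y \<in> K\<rbrakk> \<Longrightarrow> norm (W y - W x) \<le> lip * norm (y - x)"
  and norm_DW: "x \<in> K \<Longrightarrow> norm (DW x) \<le> lip"
  and norm_W: "x \<in> K \<Longrightarrow> norm (W x) \<le> lip"
  using is_lip_lip by (auto simp: is_lip_def)

text \<open>The rate is that of \<open>gronwall_norm\<close>; the absolute value covers backward
  time.\<close>

definition growth :: "real \<Rightarrow> real" where "growth t = exp ((2 * lip + 1) * \<bar>t\<bar>)"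

lemma growth_ge_1: "1 \<le> growth t"
  using lip_pos by (simp add: growth_def)

lemma growth_mono: "\<bar>s\<bar> \<le> \<bar>t\<bar> \<Longrightarrow> growth s \<le> growth t"
  using lip_pos by (simp add: growth_def)

text \<open>A predicate on curves, because uniqueness is applied also to time shifts and to constant
  solutions.\<close>

definition trajectory :: "(real \<Rightarrow> real^2) \<Rightarrow> bool" where
  "trajectory y \<longleftrightarrow> (\<forall>t. y t \<in> K \<and> (y has_vector_derivative W (y t)) (at t))"

lemma trajectory_flow: "x \<in> K \<Longrightarrow> trajectory (\<lambda>t. \<Phi> t x)"
  using flow by (auto simp: is_flow_def trajectory_def)

lemma flow_0: "x \<in> K \<Longrightarrow> \<Phi> 0 x = x"
  and flow_in_K: "x \<in> K \<Longrightarrow> \<Phi> t x \<in> K"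
  and flow_deriv: "x \<in> K \<Longrightarrow> ((\<lambda>s. \<Phi> s x) has_vector_derivative W (\<Phi> t x)) (at t)"
  using flow by (auto simp: is_flow_def)

lemma trajectory_shift: "trajectory y \<Longrightarrow> trajectory (\<lambda>s. y (s + t))"
  unfolding trajectory_def
  using vector_diff_chain_at[of "\<lambda>s. s + t" 1 _ y]
  by (force simp: o_def intro!: derivative_eq_intros)

text \<open>Gronwall with e = 0 for the difference, and for the reversed curves when t < 0. Equal
  initial values force equal curves, so this is also the uniqueness theorem.\<close>

lemma trajectory_distance:
  assumes y: "trajectory y" and z: "trajectory z"
  shows "norm (y t - z t) \<le> growth t * norm (y 0 - z 0)"
proof (cases "0 \<le> t")
  case True
  have "norm (y t - z t) \<le> (norm (y 0 - z 0) + 0) * exp ((2 * lip + 1) * t)"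
  proof (rule gronwall_norm[where z' = "\<lambda>s. W (y s) - W (z s)"])
    show "((\<lambda>s. y s - z s) has_vector_derivative W (y s) - W (z s)) (at s)" for s
      using y z by (auto simp: trajectory_def intro!: derivative_eq_intros)
    show "norm (W (y s) - W (z s)) \<le> lip * norm (y s - z s) + 0" for s
      using y z by (auto simp: trajectory_def intro!: W_lipschitz)
  qed (use True lip_pos in auto)
  then show ?thesis using True by (simp add: growth_def mult.commute)
next
  case False
  have "norm (y (- (- t)) - z (- (- t))) \<le> (norm (y (- 0) - z (- 0)) + 0) * exp ((2 * lip + 1) * (- t))"
  proof (rule gronwall_norm[where z' = "\<lambda>s. - (W (y (- s)) - W (z (- s)))" and z = "\<lambda>s. y (- s) - z (- s)"])
    have "((\<lambda>s. y (- s)) has_vector_derivative - W (y (- s))) (at s)"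
         if "trajectory y" for s y
      using that vector_diff_chain_at[of uminus "-1" s y "W (y (- s))"]
      by (auto simp: trajectory_def o_def has_vector_derivative_minus intro!: derivative_eq_intros)
    then show "((\<lambda>s. y (- s) - z (- s)) has_vector_derivative - (W (y (- s)) - W (z (- s)))) (at s)" for s
      using y z by (auto intro!: derivative_eq_intros)
    show "norm (- (W (y (- s)) - W (z (- s)))) \<le> lip * norm (y (- s) - z (- s)) + 0" for s
      unfolding norm_minus_cancel add_0_right
      using y z by (auto simp: trajectory_def intro!: W_lipschitz)
  qed (use False lip_pos in auto)
  then show ?thesis using False by (simp add: growth_def mult.commute)
qed

lemma flow_lipschitz:
  "\<lbrakk>x \<in> K; y \<in> K\<rbrakk> \<Longrightarrow> norm (\<Phi> t x - \<Phi> t y) \<le> growth t * norm (x - y)"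
  using trajectory_distance[OF trajectory_flow trajectory_flow, of x y t] by (simp add: flow_0)

text \<open>In s, both sides solve the same equation with the same value at s = 0.\<close>

lemma flow_add:
  assumes "x \<in> K" shows "\<Phi> (s + t) x = \<Phi> s (\<Phi> t x)"
  using trajectory_distance[OF trajectory_shift[OF trajectory_flow[OF assms], of t]
      trajectory_flow[OF flow_in_K[OF assms, of t]], of s] assms
  by (simp add: flow_0 flow_in_K)

lemma flow_inverse: "x \<in> K \<Longrightarrow> \<Phi> (- t) (\<Phi> t x) = x" "x \<in> K \<Longrightarrow> \<Phi> t (\<Phi> (- t) x) = x"
  by (simp_all add: flow_0 flip: flow_add)

lemma continuous_flow: "continuous_on K (\<Phi> t)"
  unfolding continuous_on_iff
proof (intro ballI allI impI)
  fix x e assume "x \<in> K" "0 < (e::real)"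
  show "\<exists>d>0. \<forall>y\<in>K. dist y x < d \<longrightarrow> dist (\<Phi> t y) (\<Phi> t x) < e"
  proof (intro exI[of _ "e / growth t"] conjI ballI impI)
    show "0 < e / growth t" using \<open>0 < e\<close> growth_ge_1[of t] by simp
    fix y assume "y \<in> K" "dist y x < e / growth t"
    then show "dist (\<Phi> t y) (\<Phi> t x) < e"
      using flow_lipschitz[OF \<open>y \<in> K\<close> \<open>x \<in> K\<close>, of t] growth_ge_1[of t]
      by (simp add: dist_norm field_simps)
  qed
qed

lemma continuous_time: "x \<in> K \<Longrightarrow> continuous_on S (\<lambda>t. \<Phi> t x)"
  using flow_deriv has_vector_derivative_continuous
  by (intro continuous_at_imp_continuous_on) blast

text \<open>The velocity \<open>W\<close> is orthogonal to the gradient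
  \<open>rot90 W\<close>.\<close>

lemma H_flow:
  assumes "x \<in> K" shows "H (\<Phi> t x) = H x"
proof -
  have "((\<lambda>t. H (\<Phi> t x)) has_derivative (\<lambda>s. 0)) (at t)" for t
    using has_derivative_compose[OF flow_deriv[OF assms, unfolded has_vector_derivative_def] H_deriv, of t]
    by simp
  then have "H (\<Phi> t x) = H (\<Phi> 0 x)"
    by (metis has_derivative_zero_unique_connected[of UNIV "\<lambda>t. H (\<Phi> t x)"] UNIV_I open_UNIV connected_UNIV)
  then show ?thesis using assms by (simp add: flow_0)
qed

lemma flow_speed:
  assumes "x \<in> K" shows "norm (\<Phi> s x - \<Phi> t x) \<le> lip * \<bar>s - t\<bar>"
proof -
  have "norm (\<Phi> s x - \<Phi> t x) \<le> lip * norm (s - t)"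
  proof (rule differentiable_bound[where S = UNIV and f' = "\<lambda>t h. h *\<^sub>R W (\<Phi> t x)" and f = "\<lambda>t. \<Phi> t x"])
    show "((\<lambda>t. \<Phi> t x) has_derivative (\<lambda>h. h *\<^sub>R W (\<Phi> t x))) (at t)" for t
      using flow_deriv[OF assms] by (simp add: has_vector_derivative_def)
    show "onorm (\<lambda>h. h *\<^sub>R W (\<Phi> t x)) \<le> lip" for t
      using mult_right_mono[OF norm_W[OF flow_in_K[OF assms, of t]]]
      by (intro onorm_le) (simp add: mult.commute)
  qed auto
  then show ?thesis by simp
qed

section \<open>Neighbourhoods within K and transversals of the flow\<close>

definition near :: "real^2 \<Rightarrow> (real^2) filter" where
  "near p = inf (nhds p) (principal K)"

lemma eventually_near:
  "eventually P (near p) \<longleftrightarrow> (\<exists>d>0. \<forall>x\<in>K. norm (x - p) < d \<longrightarrow> P x)"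
  by (auto simp: near_def eventually_inf_principal eventually_nhds_metric dist_norm)

lemma eventually_near_self: "\<lbrakk>eventually P (near p); p \<in> K\<rbrakk> \<Longrightarrow> P p"
  by (auto simp: eventually_near)

lemma eventually_near_in: "eventually (\<lambda>q. q \<in> K) (near p)"
  by (auto simp: eventually_near intro: exI[of _ 1])

lemma eventually_near_norm: "0 < e \<Longrightarrow> eventually (\<lambda>q. c * norm (q - p) < e) (near p)"
proof -
  assume "0 < e"
  have "c * norm (q - p) < e" if "norm (q - p) < e / (\<bar>c\<bar> + 1)" for q
  proof -
    have "c * norm (q - p) \<le> (\<bar>c\<bar> + 1) * norm (q - p)"
      by (intro mult_right_mono) auto
    also have "\<dots> < e" using that by (simp add: pos_less_divide_eq mult.commute)
    finally show ?thesis .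
  qed
  moreover have "0 < e / (\<bar>c\<bar> + 1)" using \<open>0 < e\<close> by auto
  ultimately show ?thesis unfolding eventually_near by blast
qed

text \<open>Transfers a statement near \<open>p\<close> to the images under a return or sliding map
  \<open>f\<close>, whose distance to \<open>p\<close> is controlled linearly.\<close>

lemma eventually_near_map:
  assumes "eventually P (near p)"
    and "eventually (\<lambda>q. f q \<in> K \<and> norm (f q - p) \<le> c * norm (q - p)) (near p)"
  shows "eventually (\<lambda>q. P (f q)) (near p)"
proof -
  obtain d where "0 < d" "\<forall>x\<in>K. norm (x - p) < d \<longrightarrow> P x"
    using assms(1) by (auto simp: eventually_near)
  from assms(2) eventually_near_norm[OF \<open>0 < d\<close>, of c p] show ?thesis
    by eventually_elim (use \<open>\<forall>x\<in>K. norm (x - p) < d \<longrightarrow> P x\<close> in auto)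
qed

text \<open>The mean value theorem as an equality is a scalar statement, hence the projection onto
  \<open>v\<close>; in the uses below \<open>v\<close> is \<open>W p\<close>, the normal of the
  transversal.\<close>

lemma flow_mvt:
  assumes "y \<in> K"
  obtains \<xi> where "\<bar>\<xi>\<bar> \<le> \<bar>t\<bar>" "(\<Phi> t y - y) \<bullet> v = t * (W (\<Phi> \<xi> y) \<bullet> v)"
proof -
  have d: "((\<lambda>s. \<Phi> s y \<bullet> v) has_real_derivative W (\<Phi> s y) \<bullet> v) (at s)" for s
    using has_derivative_inner_left[OF flow_deriv[OF assms, of s, unfolded has_vector_derivative_def], of v]
    by (simp add: has_field_derivative_def mult_commute_abs)
  consider "t = 0" | "0 < t" | "t < 0" by linarith
  then show thesis
  proof cases
    case 1
    then show ?thesis using that[of 0] assms by (simp add: flow_0)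
  next
    case 2
    then obtain z where "0 < z" "z < t" "\<Phi> t y \<bullet> v - \<Phi> 0 y \<bullet> v = (t - 0) * (W (\<Phi> z y) \<bullet> v)"
      using MVT2[OF 2, of "\<lambda>s. \<Phi> s y \<bullet> v" "\<lambda>s. W (\<Phi> s y) \<bullet> v"] d by blast
    then show ?thesis using that[of z] assms by (simp add: flow_0 inner_diff_left)
  next
    case 3
    then obtain z where "t < z" "z < 0" "\<Phi> 0 y \<bullet> v - \<Phi> t y \<bullet> v = (0 - t) * (W (\<Phi> z y) \<bullet> v)"
      using MVT2[OF 3, of "\<lambda>s. \<Phi> s y \<bullet> v" "\<lambda>s. W (\<Phi> s y) \<bullet> v"] d by blast
    then show ?thesis using that[of z] assms by (simp add: flow_0 inner_diff_left)
  qed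
qed

lemma flow_dist_le:
  assumes "y \<in> K" "\<bar>\<tau>\<bar> \<le> c * norm (y - p)"
  shows "norm (\<Phi> \<tau> y - p) \<le> (1 + lip * c) * norm (y - p)"
proof -
  have "norm (\<Phi> \<tau> y - p) \<le> norm (\<Phi> \<tau> y - \<Phi> 0 y) + norm (y - p)"
    using assms norm_triangle_ineq[of "\<Phi> \<tau> y - y" "y - p"] by (simp add: flow_0)
  also have "norm (\<Phi> \<tau> y - \<Phi> 0 y) \<le> lip * (c * norm (y - p))"
    using order_trans[OF flow_speed[OF assms(1), of \<tau> 0], of "lip * (c * norm (y - p))"] assms(2) lip_pos
    by simp
  finally show ?thesis by (simp add: algebra_simps)
qed

lemma W_near:
  assumes "0 < e"
  obtains d where "0 < d" "\<And>x. norm (x - p) < d \<Longrightarrow> \<bar>W x \<bullet> W p - W p \<bullet> W p\<bar> < e"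
proof -
  have "continuous_on UNIV (\<lambda>x. W x \<bullet> W p)"
    by (intro continuous_intros continuous_W)
  then show thesis
    using that assms unfolding continuous_on_iff dist_norm real_norm_def by (meson UNIV_I)
qed

text \<open>The line through \<open>p\<close> orthogonal to \<open>W p\<close> is a transversal of the flow; \<open>\<sigma> y\<close> is the
  time that \<open>y\<close> needs to reach it.\<close>
lemma section_time:
  assumes p: "W p \<noteq> 0"
  shows "\<exists>\<sigma>. \<forall>e>0. eventually (\<lambda>y. \<bar>\<sigma> y\<bar> \<le> 2 / norm (W p) * norm (y - p) \<and>
      (\<Phi> (\<sigma> y) y - p) \<bullet> W p = 0 \<and>
      \<bar>(y - p) \<bullet> W p + \<sigma> y * (W p \<bullet> W p)\<bar> \<le> e * norm (y - p)) (near p)"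
proof -
  define C where "C = 2 / norm (W p)"
  define w where "w = W p \<bullet> W p"
  have w: "0 < w" and C: "0 < C" using p by (auto simp: w_def C_def)
  have near_speed: "eventually (\<lambda>y. \<forall>\<tau>. \<bar>\<tau>\<bar> \<le> C * norm (y - p) \<longrightarrow> \<bar>W (\<Phi> \<tau> y) \<bullet> W p - w\<bar> < e) (near p)"
    if e: "0 < e" for e
  proof -
    obtain d where d: "0 < d" "\<And>x. norm (x - p) < d \<Longrightarrow> \<bar>W x \<bullet> W p - w\<bar> < e"
      using W_near[OF e, of p] unfolding w_def by metis
    show ?thesis
      using eventually_near_norm[OF d(1), of "1 + lip * C" p] eventually_near_in[of p]
    proof eventually_elim
      case (elim y)
      then show ?case using flow_dist_le[OF elim(2), of _ C p] d(2) by (meson order_le_less_trans)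
    qed
  qed
  have "eventually (\<lambda>y. \<exists>\<tau>. \<bar>\<tau>\<bar> \<le> C * norm (y - p) \<and> (\<Phi> \<tau> y - p) \<bullet> W p = 0) (near p)"
    using near_speed[OF half_gt_zero[OF w]] eventually_near_in[of p]
  proof eventually_elim
    case (elim y)
    define b where "b = C * norm (y - p)"
    have b: "0 \<le> b" using C by (simp add: b_def)
    \<comment> \<open>In time b the flow gains at least b w / 2 in direction \<open>W p\<close>, as
      the speed there stays above w / 2. The factor 2 in C makes this gain equal to |y - p| |W p|,
      which outweighs the initial offset in either direction of time.\<close>
    have "b * (w / 2) = norm (y - p) * norm (W p)"
      using p unfolding b_def C_def w_def by (simp add: dot_square_norm power2_eq_square field_simps)
    then have gy: "\<bar>(y - p) \<bullet> W p\<bar> \<le> b * (w / 2)"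
      using Cauchy_Schwarz_ineq2[of "y - p" "W p"] by simp
    obtain x1 where x1: "\<bar>x1\<bar> \<le> \<bar>b\<bar>" "(\<Phi> b y - y) \<bullet> W p = b * (W (\<Phi> x1 y) \<bullet> W p)"
      using flow_mvt[OF elim(2)] by metis
    obtain x2 where x2: "\<bar>x2\<bar> \<le> \<bar>- b\<bar>" "(\<Phi> (- b) y - y) \<bullet> W p = - b * (W (\<Phi> x2 y) \<bullet> W p)"
      using flow_mvt[OF elim(2)] by metis
    have "\<bar>W (\<Phi> x1 y) \<bullet> W p - w\<bar> < w / 2" "\<bar>W (\<Phi> x2 y) \<bullet> W p - w\<bar> < w / 2"
      using elim(1) x1(1) x2(1) b by (simp_all add: b_def)
    then have "w / 2 \<le> W (\<Phi> x1 y) \<bullet> W p" "w / 2 \<le> W (\<Phi> x2 y) \<bullet> W p" by linarith+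
    then have "b * (w / 2) \<le> (\<Phi> b y - y) \<bullet> W p" "(\<Phi> (- b) y - y) \<bullet> W p \<le> - (b * (w / 2))"
      using x1(2) x2(2) mult_left_mono[OF _ b, of "w / 2" "W (\<Phi> x1 y) \<bullet> W p"]
        mult_left_mono[OF _ b, of "w / 2" "W (\<Phi> x2 y) \<bullet> W p"] by simp_all
    then have "(\<Phi> (- b) y - p) \<bullet> W p \<le> 0" "0 \<le> (\<Phi> b y - p) \<bullet> W p"
      using gy unfolding inner_diff_left by linarith+
    moreover have "continuous_on {- b..b} (\<lambda>t. (\<Phi> t y - p) \<bullet> W p)"
      by (intro continuous_intros continuous_time elim(2))
    ultimately obtain \<tau> where "- b \<le> \<tau>" "\<tau> \<le> b" "(\<Phi> \<tau> y - p) \<bullet> W p = 0"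
      using IVT'[of "\<lambda>t. (\<Phi> t y - p) \<bullet> W p" "- b" 0 b] b by auto
    then show ?case unfolding b_def by (intro exI[of _ \<tau>]) auto
  qed
  \<comment> \<open>\<open>P\<close> does not involve the accuracy e, so one choice of \<sigma>
    serves all e; the third estimate then follows from \<open>P\<close> near
    \<open>p\<close>.\<close>
  define P where "P y \<tau> \<longleftrightarrow> \<bar>\<tau>\<bar> \<le> C * norm (y - p) \<and> (\<Phi> \<tau> y - p) \<bullet> W p = 0" for y \<tau>
  define \<sigma> where "\<sigma> y = (SOME \<tau>. P y \<tau>)" for y
  have ex: "eventually (\<lambda>y. P y (\<sigma> y)) (near p)"
    using \<open>eventually (\<lambda>y. \<exists>\<tau>. \<bar>\<tau>\<bar> \<le> C * norm (y - p) \<and> _ y \<tau>) (near p)\<close>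
    unfolding \<sigma>_def P_def by (rule eventually_mono) (rule someI_ex)
  show ?thesis
  proof (intro exI[of _ \<sigma>] allI impI)
    fix e :: real assume "0 < e"
    then have "0 < e / C" using C by simp
    show "eventually (\<lambda>y. \<bar>\<sigma> y\<bar> \<le> 2 / norm (W p) * norm (y - p) \<and>
      (\<Phi> (\<sigma> y) y - p) \<bullet> W p = 0 \<and>
      \<bar>(y - p) \<bullet> W p + \<sigma> y * (W p \<bullet> W p)\<bar> \<le> e * norm (y - p)) (near p)"
      using ex near_speed[OF \<open>0 < e / C\<close>] eventually_near_in[of p]
    proof eventually_elim
      case (elim y)
      obtain \<xi> where \<xi>: "\<bar>\<xi>\<bar> \<le> \<bar>\<sigma> y\<bar>" "(\<Phi> (\<sigma> y) y - y) \<bullet> W p = \<sigma> y * (W (\<Phi> \<xi> y) \<bullet> W p)"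
        using flow_mvt[OF elim(3)] by metis
      have "\<bar>W (\<Phi> \<xi> y) \<bullet> W p - w\<bar> < e / C"
        using elim \<xi> by (auto simp: P_def)
      \<comment> \<open>The error is the travel time, of order |y - p|, times the deviation of the
        speed from w, which is small near \<open>p\<close>.\<close>
      moreover have eq: "(y - p) \<bullet> W p + \<sigma> y * w = - (\<sigma> y * (W (\<Phi> \<xi> y) \<bullet> W p - w))"
        using elim(1) \<xi>(2) by (simp add: P_def inner_diff_left algebra_simps)
      ultimately have "\<bar>(y - p) \<bullet> W p + \<sigma> y * w\<bar> \<le> C * norm (y - p) * (e / C)"
        using elim(1) C unfolding P_def eq abs_minus_cancel abs_mult by (intro mult_mono) auto
      then show ?case using elim(1) C by (simp add: P_def C_def w_def mult.commute)
    qed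
  qed
qed

text \<open>For y - y' = r \<open>rot90 (W p)\<close>, the mean value theorem gives H y - H y' = r
  (W \<xi> \<bullet> W p), and the inner product is positive near \<open>p\<close>: H is strictly
  monotone along the transversal.\<close>

lemma section_injective:
  assumes "W p \<noteq> 0"
  obtains d where "0 < d" "\<And>y y'. \<lbrakk>norm (y - p) < d; norm (y' - p) < d;
      (y - p) \<bullet> W p = 0; (y' - p) \<bullet> W p = 0; H y = H y'\<rbrakk> \<Longrightarrow> y = y'"
proof -
  define w where "w = W p \<bullet> W p"
  have w: "0 < w" using assms by (auto simp: w_def)
  obtain d where d: "0 < d" "\<And>x. norm (x - p) < d \<Longrightarrow> \<bar>W x \<bullet> W p - w\<bar> < w"
    using W_near[OF w, of p] unfolding w_def by metis
  show thesis
  proof (rule that[OF d(1)])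
    fix y y' assume y: "norm (y - p) < d" "norm (y' - p) < d"
      "(y - p) \<bullet> W p = 0" "(y' - p) \<bullet> W p = 0" "H y = H y'"
    define r where "r = (y - y') \<bullet> rot90 (W p) / w"
    have "(y - y') \<bullet> W p = 0" using y by (simp add: inner_diff_left)
    then have "w *\<^sub>R (y - y') = ((y - y') \<bullet> rot90 (W p)) *\<^sub>R rot90 (W p)"
      using rot90_decomposition[of "W p" "y - y'"] by (simp add: w_def)
    then have r: "y - y' = r *\<^sub>R rot90 (W p)"
      using w unfolding r_def by (metis (no_types, lifting) divide_inverse less_numeral_extra(3) mult.commute
          real_vector_affinity_eq right_inverse scaleR_cancel_left scaleR_one scaleR_scaleR)
    obtain \<xi> where \<xi>: "\<xi> \<in> closed_segment y' y" "H y - H y' = rot90 (W \<xi>) \<bullet> (y - y')"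
    proof -
      have "((\<lambda>s. H (y' + s *\<^sub>R (y - y'))) has_derivative
          (\<lambda>h. rot90 (W (y' + s *\<^sub>R (y - y'))) \<bullet> (h *\<^sub>R (y - y')))) (at s within {0..1})" for s
        by (rule has_derivative_compose[OF _ H_deriv]) (auto intro!: derivative_eq_intros)
      from mvt_very_simple[OF zero_le_one this] obtain s where "s \<in> {0..1}"
        "H (y' + 1 *\<^sub>R (y - y')) - H (y' + 0 *\<^sub>R (y - y'))
          = rot90 (W (y' + s *\<^sub>R (y - y'))) \<bullet> ((1 - 0) *\<^sub>R (y - y'))"
        by blast
      then show thesis
        by (intro that[of "y' + s *\<^sub>R (y - y')"])
          (auto simp: in_segment scaleR_diff_left scaleR_diff_right intro!: exI[of _ s])
    qed
    have "closed_segment y' y \<subseteq> ball p d"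
      using y by (intro closed_segment_subset) (auto simp: dist_norm norm_minus_commute)
    then have "0 < W \<xi> \<bullet> W p" using \<xi>(1) d(2)[of \<xi>] by (auto simp: dist_norm norm_minus_commute)
    moreover have "r * (W \<xi> \<bullet> W p) = 0" using \<xi>(2) y(5) unfolding r by simp
    ultimately show "y = y'" using r by simp
  qed
qed

text \<open>Slide both q and \<Phi> T q along their common orbit onto the transversal. The two hits
  have the same H, so they coincide, and the orbit closes after T plus the difference of the two
  sliding times.\<close>

lemma near_return:
  assumes "p \<in> K" "W p \<noteq> 0" "\<Phi> T p = p"
  obtains c where "eventually (\<lambda>q. \<exists>t. \<Phi> t q = q \<and> \<bar>t - T\<bar> \<le> c * norm (q - p)) (near p)"
proof -
  define C where "C = 2 / norm (W p)"
  obtain \<sigma> where "eventually (\<lambda>y. \<bar>\<sigma> y\<bar> \<le> C * norm (y - p) \<and>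
      (\<Phi> (\<sigma> y) y - p) \<bullet> W p = 0 \<and>
      \<bar>(y - p) \<bullet> W p + \<sigma> y * (W p \<bullet> W p)\<bar> \<le> 1 * norm (y - p)) (near p)"
    using section_time[OF assms(2)] zero_less_one unfolding C_def by blast
  then have \<sigma>: "eventually (\<lambda>y. \<bar>\<sigma> y\<bar> \<le> C * norm (y - p) \<and> (\<Phi> (\<sigma> y) y - p) \<bullet> W p = 0) (near p)"
    by (rule eventually_mono) auto
  obtain d where d: "0 < d" "\<And>y y'. \<lbrakk>norm (y - p) < d; norm (y' - p) < d;
      (y - p) \<bullet> W p = 0; (y' - p) \<bullet> W p = 0; H y = H y'\<rbrakk> \<Longrightarrow> y = y'"
    using section_injective[OF assms(2)] by metis
  have T: "eventually (\<lambda>q. \<Phi> T q \<in> K \<and> norm (\<Phi> T q - p) \<le> growth T * norm (q - p)) (near p)"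
    using eventually_near_in[of p]
  proof eventually_elim
    case (elim q)
    show ?case using flow_lipschitz[OF elim assms(1), of T] flow_in_K[OF elim] assms(3) by simp
  qed
  have small: "eventually (\<lambda>y. (1 + lip * C) * norm (y - p) < d) (near p)"
    using eventually_near_norm[OF d(1)] .
  have C: "0 \<le> C" by (simp add: C_def)
  show thesis
  proof (rule that)
    show "eventually (\<lambda>q. \<exists>t. \<Phi> t q = q \<and> \<bar>t - T\<bar> \<le> (C + C * growth T) * norm (q - p)) (near p)"
      using \<sigma> eventually_near_map[OF \<sigma> T] small eventually_near_map[OF small T] T eventually_near_in[of p]
    proof eventually_elim
      case (elim q)
      let ?q1 = "\<Phi> T q"
      let ?a = "\<sigma> q" and ?b = "\<sigma> ?q1"
      have "\<Phi> ?a q = \<Phi> ?b ?q1"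
      proof (rule d(2))
        show "norm (\<Phi> ?a q - p) < d" "norm (\<Phi> ?b ?q1 - p) < d"
          using flow_dist_le[of q ?a C p] flow_dist_le[of ?q1 ?b C p] elim by auto
        show "H (\<Phi> ?a q) = H (\<Phi> ?b ?q1)" using elim by (simp add: H_flow)
      qed (use elim in auto)
      then have "\<Phi> (- ?a) (\<Phi> (?b + T) q) = q"
        using elim by (metis flow_add flow_inverse(1))
      then have "\<Phi> (T + ?b - ?a) q = q"
        using elim flow_add[of q "- ?a" "?b + T"] by (simp add: algebra_simps)
      moreover have "\<bar>?b\<bar> \<le> C * (growth T * norm (q - p))"
        using elim mult_left_mono[OF _ C] by (meson order_trans)
      ultimately show ?case
        using elim by (intro exI[of _ "T + ?b - ?a"]) (auto simp: algebra_simps)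
    qed
  qed
qed

text \<open>As long as the orbit stays within d of \<open>p\<close>, it advances strictly in
  direction \<open>W p\<close>. A start within d/2 and the speed bound \<open>lip\<close> ensure
  this up to time d / (2 lip).\<close>

lemma no_immediate_return:
  assumes "W p \<noteq> 0"
  obtains s0 where "0 < s0" "eventually (\<lambda>q. \<forall>s. 0 < s \<and> s \<le> s0 \<longrightarrow> \<Phi> s q \<noteq> q) (near p)"
proof -
  have "0 < W p \<bullet> W p" using assms by simp
  then obtain d where d: "0 < d" "\<And>x. norm (x - p) < d \<Longrightarrow> \<bar>W x \<bullet> W p - W p \<bullet> W p\<bar> < W p \<bullet> W p"
    using W_near by metis
  define s0 where "s0 = d / (2 * lip)"
  have s0: "0 < s0" "lip * s0 = d / 2" using d lip_pos by (simp_all add: s0_def)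
  show thesis
  proof (rule that[OF s0(1)])
    have "eventually (\<lambda>q. 1 * norm (q - p) < d / 2) (near p)"
      using d by (intro eventually_near_norm) simp
    then show "eventually (\<lambda>q. \<forall>s. 0 < s \<and> s \<le> s0 \<longrightarrow> \<Phi> s q \<noteq> q) (near p)"
      using eventually_near_in[of p]
    proof eventually_elim
      case (elim q)
      show ?case
      proof (intro allI impI)
        fix s assume s: "0 < s \<and> s \<le> s0"
        obtain \<xi> where \<xi>: "\<bar>\<xi>\<bar> \<le> \<bar>s\<bar>" "(\<Phi> s q - q) \<bullet> W p = s * (W (\<Phi> \<xi> q) \<bullet> W p)"
          using flow_mvt[OF elim(2)] by metis
        have "lip * \<bar>\<xi>\<bar> \<le> lip * s0" using \<xi> s lip_pos by (intro mult_left_mono) auto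
        then have "norm (\<Phi> \<xi> q - q) \<le> d / 2"
          using flow_speed[OF elim(2), of \<xi> 0] elim s0 by (simp add: flow_0)
        then have "norm (\<Phi> \<xi> q - p) < d"
          using elim(1) norm_triangle_ineq[of "\<Phi> \<xi> q - q" "q - p"] by simp
        then have "0 < W (\<Phi> \<xi> q) \<bullet> W p" using d(2) by fastforce
        then show "\<Phi> s q \<noteq> q" using \<xi>(2) s by auto
      qed
    qed
  qed
qed

text \<open>Short times are excluded by \<open>no_immediate_return\<close>. On the compact rest
  [s0, b] the orbit of \<open>p\<close> keeps a positive distance from \<open>p\<close>, and nearby
  orbits follow it closely.\<close>

lemma no_return_near:
  assumes "p \<in> K" "W p \<noteq> 0" and no: "\<And>s. \<lbrakk>0 < s; s \<le> b\<rbrakk> \<Longrightarrow> \<Phi> s p \<noteq> p"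
  shows "eventually (\<lambda>q. \<forall>s. 0 < s \<and> s \<le> b \<longrightarrow> \<Phi> s q \<noteq> q) (near p)"
proof -
  obtain s0 where s0: "0 < s0" "eventually (\<lambda>q. \<forall>s. 0 < s \<and> s \<le> s0 \<longrightarrow> \<Phi> s q \<noteq> q) (near p)"
    using no_immediate_return[OF assms(2)] by blast
  show ?thesis
  proof (cases "s0 \<le> b")
    case False
    then show ?thesis using s0(2) by (elim eventually_mono) auto
  next
    case True
    have "continuous_on {s0..b} (\<lambda>s. norm (\<Phi> s p - p))"
      by (intro continuous_intros continuous_time assms)
    then obtain s1 where s1: "s1 \<in> {s0..b}" "\<And>s. s \<in> {s0..b} \<Longrightarrow> norm (\<Phi> s1 p - p) \<le> norm (\<Phi> s p - p)"
      using continuous_attains_inf[of "{s0..b}" "\<lambda>s. norm (\<Phi> s p - p)"] True by auto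
    then have "0 < norm (\<Phi> s1 p - p)" using no[of s1] s0 by auto
    from s0(2) eventually_near_norm[OF this, of "growth b + 1" p] eventually_near_in[of p]
    show ?thesis
    proof eventually_elim
      case (elim q)
      show ?case
      proof (intro allI impI notI)
        fix s assume s: "0 < s \<and> s \<le> b" and "\<Phi> s q = q"
        then have "s \<in> {s0..b}" using elim(1) by force
        then have "norm (\<Phi> s1 p - p) \<le> norm (\<Phi> s p - p)" by (rule s1)
        also have "\<dots> \<le> norm (\<Phi> s p - \<Phi> s q) + norm (q - p)"
          using norm_triangle_ineq[of "\<Phi> s p - \<Phi> s q" "q - p"] \<open>\<Phi> s q = q\<close> by simp
        also have "norm (\<Phi> s p - \<Phi> s q) \<le> growth s * norm (p - q)"
          using assms elim by (intro flow_lipschitz)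
        also have "growth s * norm (p - q) \<le> growth b * norm (q - p)"
          unfolding norm_minus_commute[of p] using s by (intro mult_right_mono growth_mono) auto
        finally show False using elim(2) by (simp add: algebra_simps)
      qed
    qed
  qed
qed

section \<open>Minimal periods and their dependence on the point\<close>

lemma orbit_period_eqI:
  assumes "0 < t" "\<Phi> t q = q" "\<And>s. \<lbrakk>0 < s; s < t\<rbrakk> \<Longrightarrow> \<Phi> s q \<noteq> q"
  shows "orbit_period \<Phi> q = ereal t"
  unfolding orbit_period_def
  using assms by (intro antisym Inf_lower Inf_greatest) (auto simp: not_less intro: leI)

text \<open>The maps \<open>\<Phi> t\<close> and \<open>\<Phi> s\<close> commute, so all points of
  an orbit share their return times. This allows T to be evaluated after sliding.\<close>

lemma orbit_period_shift:
  assumes "x \<in> K" shows "orbit_period \<Phi> (\<Phi> s x) = orbit_period \<Phi> x"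
proof -
  have "\<Phi> t (\<Phi> s x) = \<Phi> s x \<longleftrightarrow> \<Phi> t x = x" for t
  proof -
    have "\<Phi> t (\<Phi> s x) = \<Phi> s (\<Phi> t x)"
      using assms by (simp add: add.commute flip: flow_add)
    then show ?thesis using flow_inverse(1)[OF flow_in_K[OF assms, of t], of s] flow_inverse(1)[OF assms, of s] by auto
  qed
  then show ?thesis by (simp add: orbit_period_def)
qed

text \<open>A stationary point returns at every time and has period 0, so \<open>W p\<close> cannot
  vanish. Then the return times form a closed set bounded away from 0, and their infimum is
  attained.\<close>

lemma orbit_period_cases:
  assumes p: "p \<in> K" and "orbit_period \<Phi> p \<noteq> 0" "orbit_period \<Phi> p \<noteq> \<infinity>"
  obtains T where "0 < T" "orbit_period \<Phi> p = ereal T" "\<Phi> T p = p" "W p \<noteq> 0"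
    "\<And>s. \<lbrakk>0 < s; s < T\<rbrakk> \<Longrightarrow> \<Phi> s p \<noteq> p"
proof -
  define S where "S = {t. 0 < t \<and> \<Phi> t p = p}"
  have S: "S \<noteq> {}"
  proof
    assume "S = {}"
    then have "orbit_period \<Phi> p = Inf (ereal ` {})" unfolding orbit_period_def S_def by (rule arg_cong)
    then show False using assms(3) by (simp add: top_ereal_def)
  qed
  have W: "W p \<noteq> 0"
  proof
    assume "W p = 0"
    then have "trajectory (\<lambda>t. p)" using p by (simp add: trajectory_def)
    from trajectory_distance[OF trajectory_flow[OF p] this] have const: "\<Phi> t p = p" for t
      using p by (simp add: flow_0)
    have "orbit_period \<Phi> p \<le> 0 + ereal e" if "0 < e" for e
      unfolding orbit_period_def by (rule Inf_lower) (use that const in auto)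
    then have "orbit_period \<Phi> p \<le> 0"
      by (rule ereal_le_epsilon2)
    moreover have "0 \<le> orbit_period \<Phi> p"
      unfolding orbit_period_def by (intro Inf_greatest) auto
    ultimately show False using assms(2) by auto
  qed
  obtain s0 where s0: "0 < s0" "eventually (\<lambda>q. \<forall>s. 0 < s \<and> s \<le> s0 \<longrightarrow> \<Phi> s q \<noteq> q) (near p)"
    using no_immediate_return[OF W] by blast
  then have "\<forall>s. 0 < s \<and> s \<le> s0 \<longrightarrow> \<Phi> s p \<noteq> p" using eventually_near_self[OF _ p] by blast
  with s0(1) have S_eq: "S = {t\<in>{s0..}. \<Phi> t p - p \<in> {0}}"
    by (force simp: S_def not_le)
  have "closed S"
    unfolding S_eq by (rule continuous_closed_preimage[unfolded vimage_def Int_def mem_Collect_eq])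
      (auto intro!: continuous_intros continuous_time p)
  moreover have bdd: "bdd_below S" unfolding S_eq by (auto intro!: bdd_belowI[of _ s0])
  ultimately have "Inf S \<in> S" using S by (intro closed_contains_Inf)
  moreover have "\<Phi> s p \<noteq> p" if "0 < s" "s < Inf S" for s
    using cInf_lower[OF _ bdd, of s] that by (auto simp: S_def)
  ultimately show thesis
    using that[of "Inf S"] orbit_period_eqI[of "Inf S" p] W by (auto simp: S_def)
qed

lemma orbit_period_real:
  assumes p: "p \<in> K" "orbit_period \<Phi> p = ereal T" "0 < T"
  shows "\<Phi> T p = p" "W p \<noteq> 0" "\<lbrakk>0 < s; s < T\<rbrakk> \<Longrightarrow> \<Phi> s p \<noteq> p"
proof -
  have "orbit_period \<Phi> p \<noteq> 0" "orbit_period \<Phi> p \<noteq> \<infinity>" using p by auto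
  then obtain T' where T': "orbit_period \<Phi> p = ereal T'" "\<Phi> T' p = p" "W p \<noteq> 0"
    "\<And>s. \<lbrakk>0 < s; s < T'\<rbrakk> \<Longrightarrow> \<Phi> s p \<noteq> p"
    using orbit_period_cases[OF p(1)] by blast
  have "T' = T" using T'(1) p by simp
  then show "\<Phi> T p = p" "W p \<noteq> 0" "\<lbrakk>0 < s; s < T\<rbrakk> \<Longrightarrow> \<Phi> s p \<noteq> p"
    using T' by auto
qed

lemma flow_periodic:
  assumes "x \<in> K" "\<Phi> T x = x" shows "\<Phi> (of_int n * T) x = x"
proof -
  have nat: "\<Phi> (real k * T) x = x" for k
  proof (induction k)
    case 0
    then show ?case using assms by (simp add: flow_0)
  next
    case (Suc k)
    then show ?case using assms flow_add[of x "T" "real k * T"] by (simp add: algebra_simps)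
  qed
  show ?thesis
  proof (cases "0 \<le> n")
    case True
    then show ?thesis using nat[of "nat n"] by simp
  next
    case False
    then have "\<Phi> (of_int n * T) (\<Phi> (real (nat (- n)) * T) x) = x"
      using assms by (simp add: flow_0 flip: flow_add)
    then show ?thesis using nat by simp
  qed
qed

text \<open>A return at s < t entails a return at t - s. Near \<open>p\<close> no return occurs up
  to 3T/4, so both would exceed 3T/4 and t would exceed 3T/2, against t < 5T/4.\<close>

lemma period_unique_near:
  assumes p: "p \<in> K" "orbit_period \<Phi> p = ereal T" "0 < T"
  shows "eventually (\<lambda>q. \<forall>t. \<Phi> t q = q \<and> \<bar>t - T\<bar> < T / 4 \<longrightarrow> orbit_period \<Phi> q = ereal t) (near p)"
proof -
  have W: "W p \<noteq> 0" and no: "\<And>s. \<lbrakk>0 < s; s \<le> 3 / 4 * T\<rbrakk> \<Longrightarrow> \<Phi> s p \<noteq> p"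
    using orbit_period_real[OF p] p(3) by auto
  have "eventually (\<lambda>q. \<forall>s. 0 < s \<and> s \<le> 3 / 4 * T \<longrightarrow> \<Phi> s q \<noteq> q) (near p)"
    by (intro no_return_near p(1) W no)
  from this eventually_near_in[of p] show ?thesis
  proof eventually_elim
    case (elim q)
    show ?case
    proof (intro allI impI)
      fix t assume t: "\<Phi> t q = q \<and> \<bar>t - T\<bar> < T / 4"
      show "orbit_period \<Phi> q = ereal t"
      proof (rule orbit_period_eqI)
        show "\<Phi> s q \<noteq> q" if s: "0 < s" "s < t" for s
        proof
          assume ret: "\<Phi> s q = q"
          have "\<Phi> (t - s) q = q"
            using flow_add[of q "t - s" s] elim(2) t ret by simp
          have "\<not> s \<le> 3 / 4 * T" using elim(1) s(1) ret by blast
          moreover have "\<not> t - s \<le> 3 / 4 * T" using elim(1)[rule_format, of "t - s"] s(2) \<open>\<Phi> (t - s) q = q\<close> by auto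
          ultimately have "3 / 4 * T < s" "3 / 4 * T < t - s" by auto
          then show False using t p(3) by (auto simp: abs_less_iff)
        qed
        show "0 < t" using t p(3) by linarith
      qed (use t in auto)
    qed
  qed
qed

text \<open>A comparison with the one point \<open>p\<close>, with a constant depending on it:
  enough for local boundedness of T and for the lower bound on the mixing scale, which works near a
  single point.\<close>

lemma period_lipschitz_at:
  assumes p: "p \<in> K" "orbit_period \<Phi> p = ereal T" "0 < T"
  obtains c where "0 < c" "eventually (\<lambda>q. \<exists>T'>0. orbit_period \<Phi> q = ereal T' \<and> \<Phi> T' q = q \<and>
      \<bar>T' - T\<bar> \<le> c * norm (q - p)) (near p)"
proof -
  have "W p \<noteq> 0" "\<Phi> T p = p"
    using orbit_period_real[OF p] p(3) by auto
  then obtain c where c: "eventually (\<lambda>q. \<exists>t. \<Phi> t q = q \<and> \<bar>t - T\<bar> \<le> c * norm (q - p)) (near p)"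
    using near_return[OF p(1)] by blast
  show thesis
  proof (rule that)
    show "0 < max c 1" by simp
    have "0 < T / 4" using p(3) by simp
    from c period_unique_near[OF p] eventually_near_norm[OF this, of "c" p]
    show "eventually (\<lambda>q. \<exists>T'>0. orbit_period \<Phi> q = ereal T' \<and> \<Phi> T' q = q \<and>
      \<bar>T' - T\<bar> \<le> max c 1 * norm (q - p)) (near p)"
    proof eventually_elim
      case (elim q)
      then obtain t where t: "\<Phi> t q = q" "\<bar>t - T\<bar> \<le> c * norm (q - p)" by blast
      moreover have "\<bar>t - T\<bar> < T / 4" using t elim by simp
      moreover have "0 < t" using calculation p(3) by linarith
      moreover have "c * norm (q - p) \<le> max c 1 * norm (q - p)" by (intro mult_right_mono) auto
      ultimately show ?case using elim(2) by (intro exI[of _ t]) auto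
    qed
  qed
qed

section \<open>Differentiability of the flow and of the period\<close>

text \<open>No variational equation is solved: by Gronwall's inequality the difference quotients
  form a Cauchy family.\<close>
lemma flow_directional_derivative:
  assumes p: "p \<in> interior K" and t: "0 \<le> t"
  obtains D where "\<And>e. 0 < e \<Longrightarrow> \<exists>d>0. \<forall>h. \<bar>h\<bar> < d \<longrightarrow>
      norm (\<Phi> t (p + h *\<^sub>R v) - \<Phi> t p - h *\<^sub>R D) \<le> e * \<bar>h\<bar>"
proof -
  have pK: "p \<in> K" using p interior_subset by blast
  obtain r where r: "0 < r" "ball p r \<subseteq> K" using p by (auto simp: mem_interior)
  define r' where "r' = r / (norm v + 1)"
  have "0 < norm v + 1" by (simp add: add_nonneg_pos)
  then have r': "0 < r'" using r by (simp add: r'_def)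
  have inK: "p + h *\<^sub>R v \<in> K" if "\<bar>h\<bar> < r'" for h
  proof -
    have "\<bar>h\<bar> * norm v \<le> \<bar>h\<bar> * (norm v + 1)" by (intro mult_left_mono) auto
    also have "\<dots> < r" using that \<open>0 < norm v + 1\<close> by (simp add: r'_def pos_less_divide_eq)
    finally show ?thesis using r by (auto simp: dist_norm subset_iff)
  qed
  define u where "u h s = (1 / h) *\<^sub>R (\<Phi> s (p + h *\<^sub>R v) - \<Phi> s p)" for h s
  define u' where "u' h s = (1 / h) *\<^sub>R (W (\<Phi> s (p + h *\<^sub>R v)) - W (\<Phi> s p))" for h s
  \<comment> \<open>Bounds |\<Phi> s (p + hv) - \<Phi> s p| / |h| on [0, t]; the summand 1 makes it
    positive even if v = 0.\<close>
  define G where "G = growth t * norm v + 1"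
  have G: "1 \<le> G" using growth_ge_1[of t] by (simp add: G_def)
  \<comment> \<open>The quotients \<open>u h\<close> solve the linearized equation along the orbit
    of \<open>p\<close> up to an error that is uniform in s.\<close>
  have linearized: "\<exists>d>0. \<forall>h. h \<noteq> 0 \<and> \<bar>h\<bar> < d \<longrightarrow> \<bar>h\<bar> < r' \<and>
      (\<forall>s\<in>{0..t}. norm (u' h s - DW (\<Phi> s p) (u h s)) \<le> e)" if "0 < e" for e
  proof -
    have "0 < e / G" using that G by simp
    then obtain d where d: "0 < d" "\<And>x y. \<lbrakk>x \<in> K; y \<in> K; norm (y - x) < d\<rbrakk>
        \<Longrightarrow> norm (W y - W x - DW x (y - x)) \<le> e / G * norm (y - x)"
      using uniform_remainder by blast
    show ?thesis
    proof (intro exI[of _ "min r' (d / G)"] conjI allI impI ballI)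
      show "0 < min r' (d / G)" using r' d G by simp
      fix h :: real assume h: "h \<noteq> 0 \<and> \<bar>h\<bar> < min r' (d / G)"
      then show "\<bar>h\<bar> < r'" by simp
      then have K: "p + h *\<^sub>R v \<in> K" by (rule inK)
      fix s assume s: "s \<in> {0..t}"
      let ?y = "\<Phi> s (p + h *\<^sub>R v)" and ?x = "\<Phi> s p"
      have "norm (?y - ?x) \<le> growth s * norm (h *\<^sub>R v)"
        using flow_lipschitz[OF K pK, of s] by simp
      also have "\<dots> \<le> growth t * norm (h *\<^sub>R v)"
        using s by (intro mult_right_mono growth_mono) auto
      also have "\<dots> \<le> G * \<bar>h\<bar>" by (simp add: G_def algebra_simps)
      finally have dist: "norm (?y - ?x) \<le> G * \<bar>h\<bar>" .
      also have "\<dots> < d" using h G by (simp add: pos_less_divide_eq mult.commute)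
      finally have "norm (W ?y - W ?x - DW ?x (?y - ?x)) \<le> e / G * norm (?y - ?x)"
        by (intro d(2) flow_in_K pK K)
      also have "\<dots> \<le> e / G * (G * \<bar>h\<bar>)" using that G by (intro mult_left_mono dist) auto
      finally have "norm (W ?y - W ?x - DW ?x (?y - ?x)) \<le> e * \<bar>h\<bar>" using G by simp
      moreover have "u' h s - DW ?x (u h s) = (1 / h) *\<^sub>R (W ?y - W ?x - DW ?x (?y - ?x))"
        unfolding u_def u'_def blinfun.scaleR_right by (rule scaleR_diff_right[symmetric])
      ultimately show "norm (u' h s - DW ?x (u h s)) \<le> e"
        using h by (simp only: norm_scaleR) (simp add: pos_divide_le_eq)
    qed
  qed
  have cauchy: "\<exists>d>0. \<forall>h k. h \<noteq> 0 \<and> \<bar>h\<bar> < d \<and> k \<noteq> 0 \<and> \<bar>k\<bar> < d \<longrightarrow> norm (u h t - u k t) \<le> e"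
    if "0 < e" for e
  proof -
    \<comment> \<open>All quotients start at v, so Gronwall leaves only the two errors: 2 e1 times
      \<open>growth t\<close> is e.\<close>
    define e1 where "e1 = e / (2 * growth t)"
    have "0 < e1" using that growth_ge_1[of t] by (simp add: e1_def)
    then obtain d where d: "0 < d" "\<And>h. h \<noteq> 0 \<and> \<bar>h\<bar> < d \<Longrightarrow> \<bar>h\<bar> < r' \<and>
      (\<forall>s\<in>{0..t}. norm (u' h s - DW (\<Phi> s p) (u h s)) \<le> e1)"
      using linearized by blast
    show ?thesis
    proof (intro exI[of _ d] conjI allI impI d(1))
      fix h k assume hk: "h \<noteq> 0 \<and> \<bar>h\<bar> < d \<and> k \<noteq> 0 \<and> \<bar>k\<bar> < d"
      have der: "(u h has_vector_derivative u' h s) (at s)" if "h \<noteq> 0" "\<bar>h\<bar> < d" for h s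
        unfolding u_def u'_def
        using d(2)[of h] that inK[of h] pK
        by (intro has_vector_derivative_scaleR[where f' = 0, simplified] has_vector_derivative_diff
            flow_deriv) (auto intro!: derivative_eq_intros)
      have init: "u h 0 = v" if "h \<noteq> 0" "\<bar>h\<bar> < d" for h
        using d(2)[of h] that inK[of h] pK by (simp add: u_def flow_0)
      have "norm (u h t - u k t) \<le> (norm (u h 0 - u k 0) + 2 * e1) * exp ((2 * lip + 1) * t)"
      proof (rule gronwall_norm[where z' = "\<lambda>s. u' h s - u' k s"])
        show "((\<lambda>s. u h s - u k s) has_vector_derivative u' h s - u' k s) (at s)" for s
          using hk by (intro has_vector_derivative_diff der) auto
        fix s assume s: "0 \<le> s" "s \<le> t"
        let ?A = "DW (\<Phi> s p)"
        have "u' h s - u' k s = ?A (u h s - u k s) + ((u' h s - ?A (u h s)) - (u' k s - ?A (u k s)))"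
          by (simp add: blinfun.diff_right)
        also have "norm \<dots> \<le> norm (?A (u h s - u k s)) + (norm (u' h s - ?A (u h s)) + norm (u' k s - ?A (u k s)))"
          by (intro order_trans[OF norm_triangle_ineq] add_left_mono norm_triangle_ineq4)
        also have "\<dots> \<le> lip * norm (u h s - u k s) + (e1 + e1)"
        proof (intro add_mono)
          show "norm (?A (u h s - u k s)) \<le> lip * norm (u h s - u k s)"
            by (rule order_trans[OF norm_blinfun mult_right_mono[OF norm_DW]]) (auto intro: flow_in_K pK)
        qed (use d(2)[of h] d(2)[of k] hk s in auto)
        finally show "norm (u' h s - u' k s) \<le> lip * norm (u h s - u k s) + 2 * e1" by simp
      qed (use t lip_pos \<open>0 < e1\<close> in auto)
      also have "\<dots> = e"
        using init[of h] init[of k] hk t growth_ge_1[of t] by (simp add: e1_def growth_def)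
      finally show "norm (u h t - u k t) \<le> e" .
    qed
  qed
  \<comment> \<open>Completeness is applied along h = 1/(n+1); the Cauchy estimate then carries the
    limit over to all small h.\<close>
  define X where "X n = u (1 / real (Suc n)) t" for n
  have X_small: "\<exists>N. \<forall>n\<ge>N. 1 / real (Suc n) < d" if d: "0 < d" for d :: real
  proof -
    obtain N where N: "1 / real (Suc N) < d" using nat_approx_posE[OF d] by blast
    have "1 / real (Suc n) \<le> 1 / real (Suc N)" if "N \<le> n" for n
      using that by (simp add: frac_le)
    with N show ?thesis by (meson order_le_less_trans)
  qed
  have "Cauchy X"
  proof (rule metric_CauchyI)
    fix e :: real assume "0 < e"
    then obtain d where d: "0 < d"
      "\<And>h k. h \<noteq> 0 \<and> \<bar>h\<bar> < d \<and> k \<noteq> 0 \<and> \<bar>k\<bar> < d \<Longrightarrow> norm (u h t - u k t) \<le> e / 2"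
      using cauchy[of "e / 2"] by auto
    obtain N where "\<And>n. N \<le> n \<Longrightarrow> 1 / real (Suc n) < d" using X_small[OF d(1)] by blast
    then have "dist (X m) (X n) < e" if "N \<le> m" "N \<le> n" for m n
      using d(2)[of "1 / real (Suc m)" "1 / real (Suc n)"] that \<open>0 < e\<close>
      by (simp add: X_def dist_norm)
    then show "\<exists>M. \<forall>m\<ge>M. \<forall>n\<ge>M. dist (X m) (X n) < e" by blast
  qed
  then obtain D where D: "X \<longlonglongrightarrow> D" using Cauchy_convergent convergent_def by blast
  show thesis
  proof (rule that)
    fix e :: real assume "0 < e"
    then obtain d where d: "0 < d"
      "\<And>h k. h \<noteq> 0 \<and> \<bar>h\<bar> < d \<and> k \<noteq> 0 \<and> \<bar>k\<bar> < d \<Longrightarrow> norm (u h t - u k t) \<le> e"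
      using cauchy by blast
    have "norm (u h t - D) \<le> e" if "h \<noteq> 0" "\<bar>h\<bar> < d" for h
    proof (rule tendsto_upperbound)
      show "(\<lambda>n. norm (u h t - X n)) \<longlonglongrightarrow> norm (u h t - D)"
        by (intro tendsto_intros D)
      obtain N where "\<And>n. N \<le> n \<Longrightarrow> 1 / real (Suc n) < d" using X_small[OF d(1)] by blast
      then show "\<forall>\<^sub>F n in sequentially. norm (u h t - X n) \<le> e"
        using d(2)[of h] that unfolding eventually_sequentially X_def
        by (intro exI[of _ N] allI impI) auto
    qed auto
    then have "norm (\<Phi> t (p + h *\<^sub>R v) - \<Phi> t p - h *\<^sub>R D) \<le> e * \<bar>h\<bar>" if "\<bar>h\<bar> < d" for h
    proof (cases "h = 0")
      case False
      have "\<Phi> t (p + h *\<^sub>R v) - \<Phi> t p - h *\<^sub>R D = h *\<^sub>R (u h t - D)"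
        using False by (simp add: u_def scaleR_diff_right)
      with False that \<open>\<And>h. \<lbrakk>h \<noteq> 0; \<bar>h\<bar> < d\<rbrakk> \<Longrightarrow> norm (u h t - D) \<le> e\<close> show ?thesis
        by (simp add: mult.commute mult_left_mono)
    qed simp
    then show "\<exists>d>0. \<forall>h. \<bar>h\<bar> < d \<longrightarrow>
      norm (\<Phi> t (p + h *\<^sub>R v) - \<Phi> t p - h *\<^sub>R D) \<le> e * \<bar>h\<bar>"
      using d(1) by blast
  qed
qed

text \<open>Along the transversal the period is \<open>T\<close> plus the section time of \<open>\<Phi> T q\<close>.\<close>
lemma period_along_section:
  assumes p: "p \<in> interior K" "orbit_period \<Phi> p = ereal T" "0 < T"
  obtains a where "\<And>e. 0 < e \<Longrightarrow> eventually (\<lambda>q. (q - p) \<bullet> W p = 0 \<longrightarrow>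
      \<bar>real_of_ereal (orbit_period \<Phi> q) - T - a * ((q - p) \<bullet> rot90 (W p))\<bar> \<le> e * norm (q - p)) (near p)"
proof -
  have pK: "p \<in> K" using p interior_subset by blast
  have ret: "\<Phi> T p = p" and W: "W p \<noteq> 0" using orbit_period_real[OF pK p(2,3)] by auto
  define w where "w = W p \<bullet> W p"
  have w: "0 < w" using W by (simp add: w_def)
  define C where "C = 2 / norm (W p)"
  have C: "0 \<le> C" by (simp add: C_def)
  obtain D where D: "\<And>e. 0 < e \<Longrightarrow> \<exists>d>0. \<forall>h. \<bar>h\<bar> < d \<longrightarrow>
      norm (\<Phi> T (p + h *\<^sub>R rot90 (W p)) - \<Phi> T p - h *\<^sub>R D) \<le> e * \<bar>h\<bar>"
    using flow_directional_derivative[OF p(1)] p(3) by (metis less_imp_le)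
  obtain \<sigma> where \<sigma>: "\<And>e. 0 < e \<Longrightarrow> eventually (\<lambda>y. \<bar>\<sigma> y\<bar> \<le> C * norm (y - p) \<and>
      (\<Phi> (\<sigma> y) y - p) \<bullet> W p = 0 \<and>
      \<bar>(y - p) \<bullet> W p + \<sigma> y * w\<bar> \<le> e * norm (y - p)) (near p)"
    using section_time[OF W] unfolding C_def w_def by blast
  obtain d where d: "0 < d" "\<And>y y'. \<lbrakk>norm (y - p) < d; norm (y' - p) < d;
      (y - p) \<bullet> W p = 0; (y' - p) \<bullet> W p = 0; H y = H y'\<rbrakk> \<Longrightarrow> y = y'"
    using section_injective[OF W] by blast
  have T: "eventually (\<lambda>q. \<Phi> T q \<in> K \<and> norm (\<Phi> T q - p) \<le> growth T * norm (q - p)) (near p)"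
    using eventually_near_in[of p]
  proof eventually_elim
    case (elim q)
    show ?case using flow_lipschitz[OF elim pK, of T] flow_in_K[OF elim] ret by simp
  qed
  have small: "eventually (\<lambda>y. (1 + lip * C) * norm (y - p) < d) (near p)"
    "eventually (\<lambda>y. 1 * norm (y - p) < d) (near p)"
    "eventually (\<lambda>y. C * norm (y - p) < T / 4) (near p)"
    using p(3) by (intro eventually_near_norm d(1); simp)+
  \<comment> \<open>With q - p = h \<open>rot90 (W p)\<close>, the point \<Phi> T q is off the
    transversal by about h (D \<bullet> W p) in direction \<open>W p\<close>. Sliding back takes
    about -h (D \<bullet> W p) / w, and h = ((q - p) \<bullet> rot90 (W p)) / w gives the second
    division by w.\<close>
  define a where "a = - (D \<bullet> W p) / w / w"
  show thesis
  proof (rule that[of a])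
    fix e :: real assume e: "0 < e"
    \<comment> \<open>\<open>e1\<close> governs the sliding time, measured at \<Phi> T q and hence
      corrected by \<open>growth T\<close>; \<open>e2\<close> governs the flow derivative. Each
      contributes e/2.\<close>
    define e1 where "e1 = e * w / (2 * growth T)"
    define e2 where "e2 = e * w / 2"
    have pos: "0 < e1" "0 < e2" using e w growth_ge_1[of T] by (auto simp: e1_def e2_def)
    obtain d2 where d2: "0 < d2" "\<And>h. \<bar>h\<bar> < d2 \<Longrightarrow>
        norm (\<Phi> T (p + h *\<^sub>R rot90 (W p)) - p - h *\<^sub>R D) \<le> e2 * \<bar>h\<bar>"
      using D[OF pos(2)] ret by auto
    have nW: "norm (W p) = sqrt w" by (simp add: w_def norm_eq_sqrt_inner)
    show "eventually (\<lambda>q. (q - p) \<bullet> W p = 0 \<longrightarrow>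
      \<bar>real_of_ereal (orbit_period \<Phi> q) - T - a * ((q - p) \<bullet> rot90 (W p))\<bar> \<le> e * norm (q - p)) (near p)"
      using eventually_near_map[OF \<sigma>[OF pos(1)] T] eventually_near_map[OF small(1) T] T
        eventually_near_map[OF small(3) T] small(2) period_unique_near[OF pK p(2,3)] eventually_near_in[of p]
        eventually_near_norm[OF d2(1), of "1 / sqrt w" p]
    proof eventually_elim
      case (elim q)
      show ?case
      proof
        assume sec: "(q - p) \<bullet> W p = 0"
        define h where "h = (q - p) \<bullet> rot90 (W p) / w"
        have "w *\<^sub>R (q - p) = ((q - p) \<bullet> rot90 (W p)) *\<^sub>R rot90 (W p)"
          using rot90_decomposition[of "W p" "q - p"] sec by (simp add: w_def)
        then have "(1 / w) *\<^sub>R (w *\<^sub>R (q - p)) = h *\<^sub>R rot90 (W p)"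
          by (simp add: h_def)
        then have q: "q - p = h *\<^sub>R rot90 (W p)" using w by simp
        have nq: "norm (q - p) = \<bar>h\<bar> * sqrt w" unfolding q by (simp add: nW)
        let ?y = "\<Phi> T q" and ?b = "\<sigma> (\<Phi> T q)"
        \<comment> \<open>Both points lie on the transversal and have the same H.\<close>
        have "\<Phi> ?b ?y = q"
        proof (rule d(2))
          show "norm (\<Phi> ?b ?y - p) < d"
            using flow_dist_le[of ?y ?b C p] elim by auto
          show "H (\<Phi> ?b ?y) = H q" using elim by (simp add: H_flow)
        qed (use elim sec in auto)
        then have "\<Phi> (?b + T) q = q" using elim by (simp add: flow_add)
        \<comment> \<open>Closeness to T makes this return time the minimal one.\<close>
        moreover have "\<bar>(?b + T) - T\<bar> < T / 4" using elim by auto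
        ultimately have per: "orbit_period \<Phi> q = ereal (?b + T)" using elim by blast
        have "\<bar>h\<bar> < d2" using elim w by (simp add: nq)
        then have "norm (?y - p - h *\<^sub>R D) \<le> e2 * \<bar>h\<bar>"
          using d2(2)[of h] q by (simp add: algebra_simps)
        then have "\<bar>(?y - p - h *\<^sub>R D) \<bullet> W p\<bar> \<le> e2 * \<bar>h\<bar> * sqrt w"
          using Cauchy_Schwarz_ineq2[of "?y - p - h *\<^sub>R D" "W p"] w unfolding nW
          by (smt (verit, best) mult_right_mono real_sqrt_ge_zero)
        also have "\<dots> = w * (e / 2 * (\<bar>h\<bar> * sqrt w))"
          using w by (simp add: e2_def)
        finally have 1: "\<bar>(?y - p) \<bullet> W p - h * (D \<bullet> W p)\<bar> \<le> w * (e / 2 * norm (q - p))"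
          by (simp add: nq inner_diff_left)
        have "\<bar>(?y - p) \<bullet> W p + ?b * w\<bar> \<le> e1 * norm (?y - p)" using elim by blast
        also have "\<dots> \<le> e1 * (growth T * norm (q - p))"
          using elim pos by (intro mult_left_mono) auto
        also have "\<dots> = w * (e / 2 * norm (q - p))"
          using growth_ge_1[of T] by (simp add: e1_def)
        finally have 2: "\<bar>(?y - p) \<bullet> W p + ?b * w\<bar> \<le> w * (e / 2 * norm (q - p))" .
        have "\<bar>?b * w + h * (D \<bullet> W p)\<bar> \<le> w * (e * norm (q - p))"
        proof -
          have "w * (e * norm (q - p)) = w * (e / 2 * norm (q - p)) + w * (e / 2 * norm (q - p))"
            by simp
          then show ?thesis using 1 2 by linarith
        qed
        moreover have "a * ((q - p) \<bullet> rot90 (W p)) * w = - h * (D \<bullet> W p)"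
          using w by (simp add: a_def h_def)
        then have "?b * w + h * (D \<bullet> W p) = w * (?b - a * ((q - p) \<bullet> rot90 (W p)))"
          by (simp add: algebra_simps)
        ultimately have "\<bar>?b - a * ((q - p) \<bullet> rot90 (W p))\<bar> \<le> e * norm (q - p)"
          using w by (simp add: abs_mult)
        then show "\<bar>real_of_ereal (orbit_period \<Phi> q) - T - a * ((q - p) \<bullet> rot90 (W p))\<bar> \<le> e * norm (q - p)"
          by (simp add: per)
      qed
    qed
  qed
qed

text \<open>Let q' be the hit of the transversal by the orbit of q. Then T(q) = T(q') is T(p) + a N
  \<bullet> (q' - p) up to a small error. Also N \<bullet> (q' - p) is close to N \<bullet> (q - p),
  since N = \<nabla>H(p) and H(q') = H(q). All errors are o(|q - p|).\<close>

lemma period_has_derivative: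
  assumes p: "p \<in> interior K" "orbit_period \<Phi> p = ereal T" "0 < T"
  obtains a where "((\<lambda>q. real_of_ereal (orbit_period \<Phi> q)) has_derivative
    (\<lambda>v. a * (rot90 (W p) \<bullet> v))) (at p)"
proof -
  have pK: "p \<in> K" using p interior_subset by blast
  have W: "W p \<noteq> 0" using orbit_period_real[OF pK p(2,3)] by auto
  define \<tau> where "\<tau> q = real_of_ereal (orbit_period \<Phi> q)" for q
  define N where "N = rot90 (W p)"
  define C where "C = 2 / norm (W p)"
  have C: "0 \<le> C" by (simp add: C_def)
  define M where "M = 1 + lip * C"
  have M: "1 \<le> M" using C lip_pos by (simp add: M_def)
  obtain a where a: "\<And>e. 0 < e \<Longrightarrow> eventually (\<lambda>q. (q - p) \<bullet> W p = 0 \<longrightarrow>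
      \<bar>\<tau> q - T - a * ((q - p) \<bullet> N)\<bar> \<le> e * norm (q - p)) (near p)"
    using period_along_section[OF p] unfolding \<tau>_def N_def by blast
  obtain \<sigma> where "eventually (\<lambda>y. \<bar>\<sigma> y\<bar> \<le> C * norm (y - p) \<and>
      (\<Phi> (\<sigma> y) y - p) \<bullet> W p = 0 \<and>
      \<bar>(y - p) \<bullet> W p + \<sigma> y * (W p \<bullet> W p)\<bar> \<le> 1 * norm (y - p)) (near p)"
    using section_time[OF W] zero_less_one unfolding C_def by blast
  then have \<sigma>: "eventually (\<lambda>y. \<bar>\<sigma> y\<bar> \<le> C * norm (y - p) \<and> (\<Phi> (\<sigma> y) y - p) \<bullet> W p = 0) (near p)"
    by (rule eventually_mono) auto
  have slide: "eventually (\<lambda>q. \<Phi> (\<sigma> q) q \<in> K \<and> norm (\<Phi> (\<sigma> q) q - p) \<le> M * norm (q - p)) (near p)"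
    using \<sigma> eventually_near_in[of p]
  proof eventually_elim
    case (elim q)
    then show ?case using flow_dist_le[of q "\<sigma> q" C p] by (auto simp: flow_in_K M_def)
  qed
  have H_rem: "eventually (\<lambda>q. \<bar>H q - H p - N \<bullet> (q - p)\<bar> \<le> e * norm (q - p)) (near p)" if e: "0 < e" for e
  proof -
    obtain d where "0 < d" "\<And>y. norm (y - p) < d \<Longrightarrow> norm (H y - H p - N \<bullet> (y - p)) \<le> e * norm (y - p)"
      using H_deriv[of p] e unfolding has_derivative_at_alt N_def by blast
    then show ?thesis unfolding eventually_near real_norm_def by blast
  qed
  have ev: "eventually (\<lambda>q. \<bar>\<tau> q - \<tau> p - a * (N \<bullet> (q - p))\<bar> \<le> e * norm (q - p)) (near p)" if e: "0 < e" for e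
  proof -
    define e1 where "e1 = e / (2 * M)"
    \<comment> \<open>H is expanded at q' and at q, hence M + 1; the result is multiplied by a, and
      |a| + 1 avoids dividing by 0.\<close>
    define e2 where "e2 = e / (2 * (\<bar>a\<bar> + 1) * (M + 1))"
    have pos: "0 < e1" "0 < e2" using e M by (auto simp: e1_def e2_def)
    show ?thesis
      using \<sigma> slide eventually_near_map[OF a[OF pos(1)] slide] H_rem[OF pos(2)]
        eventually_near_map[OF H_rem[OF pos(2)] slide] eventually_near_in[of p]
    proof eventually_elim
      case (elim q)
      let ?q = "\<Phi> (\<sigma> q) q"
      have \<tau>: "\<tau> ?q = \<tau> q" "\<tau> p = T" using elim by (simp_all add: \<tau>_def orbit_period_shift p(2))
      have "\<bar>\<tau> ?q - T - a * ((?q - p) \<bullet> N)\<bar> \<le> e1 * norm (?q - p)" using elim by blast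
      also have "\<dots> \<le> e1 * (M * norm (q - p))" using elim pos by (intro mult_left_mono) auto
      also have "\<dots> = e / 2 * norm (q - p)" using M by (simp add: e1_def)
      finally have 1: "\<bar>\<tau> q - \<tau> p - a * (N \<bullet> (?q - p))\<bar> \<le> e / 2 * norm (q - p)"
        by (simp add: \<tau> inner_commute)
      have "\<bar>H ?q - H p - N \<bullet> (?q - p)\<bar> \<le> e2 * norm (?q - p)" using elim by blast
      also have "\<dots> \<le> e2 * (M * norm (q - p))" using elim pos by (intro mult_left_mono) auto
      finally have "\<bar>N \<bullet> (?q - p) - N \<bullet> (q - p)\<bar> \<le> e2 * (M * norm (q - p)) + e2 * norm (q - p)"
        using elim by (simp add: H_flow abs_le_iff)
      then have "\<bar>a\<bar> * \<bar>N \<bullet> (?q - p) - N \<bullet> (q - p)\<bar> \<le> (\<bar>a\<bar> + 1) * (e2 * (M + 1) * norm (q - p))"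
        by (intro mult_mono) (auto simp: algebra_simps)
      also have "\<dots> = e / 2 * norm (q - p)"
      proof -
        have "(\<bar>a\<bar> + 1) * (M + 1) \<noteq> 0" using M by auto
        then have "(\<bar>a\<bar> + 1) * e2 * (M + 1) = e / 2" by (simp add: e2_def field_simps)
        then show ?thesis by (simp only: flip: mult.assoc)
      qed
      finally have 2: "\<bar>a * (N \<bullet> (?q - p)) - a * (N \<bullet> (q - p))\<bar> \<le> e / 2 * norm (q - p)"
        by (simp add: abs_mult flip: right_diff_distrib)
      show ?case using 1 2 by linarith
    qed
  qed
  \<comment> \<open>\<open>near p\<close> sees only K; at an interior point this is a full
    neighbourhood.\<close>
  obtain r where r: "0 < r" "ball p r \<subseteq> K" using p(1) by (auto simp: mem_interior)
  have "\<exists>d>0. \<forall>y. norm (y - p) < d \<longrightarrow>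
      norm (\<tau> y - \<tau> p - a * (N \<bullet> (y - p))) \<le> e * norm (y - p)" if e: "0 < e" for e
  proof -
    obtain d where d: "0 < d" "\<forall>y\<in>K. norm (y - p) < d \<longrightarrow>
      \<bar>\<tau> y - \<tau> p - a * (N \<bullet> (y - p))\<bar> \<le> e * norm (y - p)"
      using ev[OF e] unfolding eventually_near by blast
    with r show ?thesis
      by (intro exI[of _ "min d r"]) (auto simp: dist_norm norm_minus_commute subset_iff)
  qed
  then have "(\<tau> has_derivative (\<lambda>v. a * (N \<bullet> v))) (at p)"
    unfolding has_derivative_at_alt
    by (auto intro: bounded_linear_const_mult bounded_linear_inner_right)
  then show thesis using that unfolding \<tau>_def N_def by blast
qed

end

section \<open>Compactness, interior cones, and mixing at a fixed time\<close>

text \<open>Finite subcover and minimum of the local constants. \<open>P\<close> must survive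
  decreasing k, so upper bounds are written as 1/k when this is applied.\<close>

lemma compact_uniform_constant:
  fixes S :: "'a::metric_space set"
  assumes "compact S"
    and mono: "\<And>x k k'. \<lbrakk>P x k; 0 < k'; k' \<le> k\<rbrakk> \<Longrightarrow> P x k'"
    and local: "\<And>p. p \<in> S \<Longrightarrow> \<exists>k>0. \<exists>r>0. \<forall>x\<in>ball p r. P x (k::real)"
  shows "\<exists>k>0. \<forall>x\<in>S. P x k"
proof -
  obtain k r where kr: "\<And>p. p \<in> S \<Longrightarrow> 0 < k p \<and> 0 < r p \<and> (\<forall>x\<in>ball p (r p). P x (k p))"
    using local by metis
  have "S \<subseteq> (\<Union>p\<in>S. ball p (r p))" using kr by force
  then obtain D where D: "D \<subseteq> S" "finite D" "S \<subseteq> (\<Union>p\<in>D. ball p (r p))"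
    using compactE_image[OF \<open>compact S\<close>, of S "\<lambda>p. ball p (r p)"] by auto
  define m where "m = Min (insert 1 (k ` D))"
  have m: "0 < m" "\<And>p. p \<in> D \<Longrightarrow> m \<le> k p"
    using D kr by (auto simp: m_def subset_iff)
  have "P x m" if x: "x \<in> S" for x
  proof -
    obtain p where "p \<in> D" "x \<in> ball p (r p)" using x D(3) by blast
    then show ?thesis using mono[OF _ m(1) m(2)] kr D(1) by blast
  qed
  then show ?thesis using m(1) by blast
qed

text \<open>The segments of a uniform interior cone contain directions transversal to any given \<open>n\<close>.\<close>
lemma lipschitz_domain_transversal_segment:
  assumes A: "bounded_lipschitz_domain A"
  shows "\<exists>h>0. \<forall>a\<in>A. \<forall>n. \<exists>e. norm e \<le> 1 / h \<and> norm n \<le> \<bar>n \<bullet> e\<bar> \<and>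
    (\<forall>r\<in>{0..h}. a + r *\<^sub>R e \<in> A)"
proof -
  \<comment> \<open>The same h bounds the parameter range and, through 1/h, the direction, so the
    condition weakens as h decreases.\<close>
  define P where "P a h \<longleftrightarrow> (a \<in> A \<longrightarrow> (\<forall>n. \<exists>e. norm e \<le> 1 / h \<and> norm n \<le> \<bar>n \<bullet> e\<bar> \<and>
    (\<forall>r\<in>{0..h}. a + r *\<^sub>R e \<in> A)))" for a :: "real^2" and h :: real
  have "open A" "compact (closure A)" using A by (auto simp: bounded_lipschitz_domain_def)
  have "\<exists>h>0. \<forall>a\<in>closure A. P a h"
  proof (rule compact_uniform_constant[OF \<open>compact (closure A)\<close>])
    fix a h h' assume P: "P a h" and h': "0 < h'" "h' \<le> h"
    have "1 / h \<le> 1 / h'" using h' by (intro divide_left_mono) auto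
    with P h' show "P a h'" unfolding P_def by (meson atLeastAtMost_iff order_trans)
  next
    fix p assume "p \<in> closure A"
    show "\<exists>h>0. \<exists>\<rho>>0. \<forall>a\<in>ball p \<rho>. P a h"
    proof (cases "p \<in> A")
      case True
      then obtain d where d: "0 < d" "ball p d \<subseteq> A" using \<open>open A\<close> by (auto simp: open_contains_ball)
      define h where "h = min 1 (d / 2)"
      have h: "0 < h" "h \<le> 1" "h \<le> d / 2" using d by (auto simp: h_def)
      have "P a h" if a: "a \<in> ball p (d / 2)" for a
        unfolding P_def
      proof (intro impI allI)
        fix n :: "real^2"
        have sgn: "norm (sgn n) \<le> 1" by (simp add: norm_sgn)
        have "norm n = n \<bullet> sgn n"
          by (cases "n = 0") (simp_all add: sgn_div_norm dot_square_norm power2_eq_square)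
        moreover have "norm (sgn n) \<le> 1 / h" using sgn h order_trans[of _ 1 "1 / h"] by simp
        moreover have "a + r *\<^sub>R sgn n \<in> A" if "r \<in> {0..h}" for r
        proof -
          have "norm (r *\<^sub>R sgn n) \<le> d / 2 * 1"
            unfolding norm_scaleR using that h sgn by (intro mult_mono) auto
          then have "norm (a + r *\<^sub>R sgn n - p) < d"
            using a norm_triangle_ineq[of "a - p" "r *\<^sub>R sgn n"]
            by (simp add: dist_norm norm_minus_commute algebra_simps)
          then show ?thesis using d by (auto simp: dist_norm norm_minus_commute)
        qed
        ultimately show "\<exists>e. norm e \<le> 1 / h \<and> norm n \<le> \<bar>n \<bullet> e\<bar> \<and> (\<forall>r\<in>{0..h}. a + r *\<^sub>R e \<in> A)"
          by (intro exI[of _ "sgn n"]) auto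
      qed
      then show ?thesis using h(1) d(1) by (intro exI[of _ h] conjI exI[of _ "d / 2"]) auto
    next
      case False
      then have "p \<in> frontier A"
        using \<open>p \<in> closure A\<close> \<open>open A\<close> by (simp add: frontier_def interior_open)
      then obtain d Q \<gamma> where "lipschitz_chart A p d Q \<gamma>"
        using A unfolding bounded_lipschitz_domain_def by blast
      then obtain L where d: "0 < d" and Q: "orthogonal_transformation Q"
        and L: "L-lipschitz_on UNIV \<gamma>"
        and chart: "A \<inter> ball p d = {x \<in> ball p d. \<gamma> (Q x $ 1) < Q x $ 2}"
        unfolding lipschitz_chart_def by blast
      have L0: "0 \<le> L" using L by (rule lipschitz_on_nonneg)
      \<comment> \<open>L + 2 will bound the direction e, so segments starting within d/2 of
        \<open>p\<close> stay inside the chart.\<close>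
      define h where "h = min 1 (d / 2) / (L + 2)"
      have h: "0 < h" "h * (L + 2) \<le> 1" "h * (L + 2) \<le> d / 2"
        using d L0 by (auto simp: h_def)
      have "P a h" if a: "a \<in> ball p (d / 2)" for a
        unfolding P_def
      proof (intro impI allI)
        assume "a \<in> A"
        moreover have "a \<in> ball p d" using a d by simp
        ultimately have "a \<in> {x \<in> ball p d. \<gamma> (Q x $ 1) < Q x $ 2}" unfolding chart[symmetric] by blast
        then have a_epi: "\<gamma> (Q a $ 1) < Q a $ 2" by blast
        fix n :: "real^2"
        have "norm (Q n) \<le> \<bar>Q n $ 1\<bar> + \<bar>Q n $ 2\<bar>"
          using norm_le_l1_cart[of "Q n"] by (simp add: sum_2)
        moreover have "\<bar>Q n $ 2\<bar> \<le> \<bar>(L + 1) * Q n $ 2\<bar>"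
          using L0 by (simp add: abs_mult mult_le_cancel_right1)
        \<comment> \<open>Of the directions (1, L + 1) and (-1, L + 1), the one whose sign suits n
          has inner product of modulus |n1| + (L + 1)|n2| with it. Both lie in the cone above the
          graph.\<close>
        ultimately have "norm (Q n) \<le> max \<bar>Q n $ 1 + (L + 1) * Q n $ 2\<bar> \<bar>- (Q n $ 1) + (L + 1) * Q n $ 2\<bar>"
          by linarith
        then have "norm (Q n) \<le> \<bar>1 * Q n $ 1 + (L + 1) * Q n $ 2\<bar> \<or>
            norm (Q n) \<le> \<bar>(- 1) * Q n $ 1 + (L + 1) * Q n $ 2\<bar>"
          by (simp add: le_max_iff_disj)
        moreover have "\<bar>1\<bar> = (1::real)" "\<bar>- 1\<bar> = (1::real)" by simp_all
        ultimately obtain s :: real where s: "\<bar>s\<bar> = 1" "norm (Q n) \<le> \<bar>s * Q n $ 1 + (L + 1) * Q n $ 2\<bar>"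
          by blast
        obtain e where e: "Q e = vector [s, L + 1]"
          using orthogonal_transformation_surj[OF Q] by (metis surjD)
        have ne: "norm e \<le> L + 2"
        proof -
          have "norm e = norm (Q e)" using Q by (simp add: orthogonal_transformation)
          also have "\<dots> \<le> \<bar>Q e $ 1\<bar> + \<bar>Q e $ 2\<bar>"
            using norm_le_l1_cart[of "Q e"] by (simp add: sum_2)
          finally show ?thesis using s L0 by (simp add: e)
        qed
        also have "L + 2 \<le> 1 / h" using h by (simp add: pos_le_divide_eq mult.commute)
        finally have "norm e \<le> 1 / h" .
        moreover have "norm n \<le> \<bar>n \<bullet> e\<bar>"
        proof -
          have "n \<bullet> e = Q n \<bullet> Q e" using Q by (simp add: orthogonal_transformation_def)
          then show ?thesis
            using s(2) Q by (simp add: inner_2 e orthogonal_transformation mult.commute)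
        qed
        moreover have "a + r *\<^sub>R e \<in> A" if r: "r \<in> {0..h}" for r
        proof -
          have "norm (r *\<^sub>R e) \<le> h * (L + 2)"
            unfolding norm_scaleR using r ne L0 by (intro mult_mono) auto
          then have "norm (a + r *\<^sub>R e - p) < d"
            using a h(3) norm_triangle_ineq[of "a - p" "r *\<^sub>R e"]
            by (simp add: dist_norm norm_minus_commute algebra_simps)
          then have "a + r *\<^sub>R e \<in> ball p d" by (simp add: dist_norm norm_minus_commute)
          moreover have "Q (a + r *\<^sub>R e) = Q a + r *\<^sub>R Q e"
            using orthogonal_transformation_linear[OF Q] by (simp add: linear_add linear_scale)
          then have comp: "Q (a + r *\<^sub>R e) $ 1 = Q a $ 1 + r * s" "Q (a + r *\<^sub>R e) $ 2 = Q a $ 2 + r * (L + 1)"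
            by (simp_all add: e)
          \<comment> \<open>The graph rises by at most L r while the segment rises by (L + 1)
            r.\<close>
          have "\<bar>\<gamma> (Q a $ 1 + r * s) - \<gamma> (Q a $ 1)\<bar> \<le> L * r"
            using lipschitz_onD[OF L, of "Q a $ 1 + r * s" "Q a $ 1"] s(1) r by (simp add: dist_norm abs_mult)
          then have "\<gamma> (Q (a + r *\<^sub>R e) $ 1) < Q (a + r *\<^sub>R e) $ 2"
            unfolding comp using a_epi r by (simp add: algebra_simps) linarith
          ultimately show ?thesis using chart by blast
        qed
        ultimately show "\<exists>e. norm e \<le> 1 / h \<and> norm n \<le> \<bar>n \<bullet> e\<bar> \<and> (\<forall>r\<in>{0..h}. a + r *\<^sub>R e \<in> A)"
          by blast
      qed
      then show ?thesis using h(1) d(1) by (intro exI[of _ h] conjI exI[of _ "d / 2"]) auto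
    qed
  qed
  then show ?thesis unfolding P_def using closure_subset by blast
qed

text \<open>Finitely many e-balls with centres x' cover F, and near each centre E contains a point y
  whose e-ball meets the open set E in positive measure; \<kappa> comes from the least of these
  finitely many measures. The radius 3e adds the steps from x to x', from x' to y, and the ball
  around y.\<close>

lemma mixed_to_scale_of_dense:
  assumes "open E" "bounded F" "0 < e" and dense: "\<And>x. x \<in> F \<Longrightarrow> \<exists>y\<in>E. norm (x - y) \<le> e"
  shows "mixed_to_scale E F (3 * e)"
proof -
  obtain y where y: "\<And>x. x \<in> F \<Longrightarrow> y x \<in> E \<and> norm (x - y x) \<le> e" using dense by metis
  have "closure F \<subseteq> (\<Union>x\<in>F. ball x e)"
    using \<open>0 < e\<close> by (force simp: closure_approachable)
  moreover have "compact (closure F)" using \<open>bounded F\<close> by simp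
  ultimately obtain D where D: "D \<subseteq> F" "finite D" "closure F \<subseteq> (\<Union>x\<in>D. ball x e)"
    using compactE_image[of "closure F" F "\<lambda>x. ball x e"] by auto
  define m where "m x = measure lebesgue (ball (y x) e \<inter> E)" for x
  define k where "k = Min (insert 1 (m ` D))"
  define b where "b = measure lebesgue (ball (0::real^2) (3 * e))"
  have b: "measure lebesgue (ball x (3 * e)) = b" for x :: "real^2"
    using \<open>0 < e\<close> by (simp add: b_def content_ball)
  have "0 < b" using \<open>0 < e\<close> by (simp add: b_def)
  have meas: "ball x r \<inter> E \<in> lmeasurable" for x r
    using \<open>open E\<close> by (intro lmeasurable_open) auto
  have "0 < m x" if "x \<in> D" for x
  proof -
    have "y x \<in> ball (y x) e \<inter> E" using y D(1) that \<open>0 < e\<close> by auto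
    then have "ball (y x) e \<inter> E \<noteq> {}" by blast
    then have "\<not> negligible (ball (y x) e \<inter> E)"
      using \<open>open E\<close> by (intro open_not_negligible) auto
    then show ?thesis
      unfolding m_def using negligible_iff_measure0[OF meas] measure_nonneg
      by (metis less_eq_real_def)
  qed
  then have k: "0 < k" "\<And>x. x \<in> D \<Longrightarrow> k \<le> m x" using D by (auto simp: k_def)
  show ?thesis
    unfolding mixed_to_scale_def b
  proof (intro exI[of _ "k / b"] conjI ballI)
    show "0 < k / b" using k \<open>0 < b\<close> by simp
    fix x assume "x \<in> F"
    then obtain x' where x': "x' \<in> D" "x \<in> ball x' e" using D(3) closure_subset by blast
    have "ball (y x') e \<inter> E \<subseteq> ball x (3 * e) \<inter> E"
    proof (intro Int_mono subsetI)
      fix z assume "z \<in> ball (y x') e"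
      then have "dist x' (y x') \<le> e" "dist (y x') z < e" using y D(1) x' by (auto simp: dist_norm)
      then show "z \<in> ball x (3 * e)"
        using x'(2) unfolding mem_ball using dist_triangle[of x z x'] dist_triangle[of x' z "y x'"]
        by (simp add: dist_commute)
    qed auto
    then have "m x' \<le> measure lebesgue (ball x (3 * e) \<inter> E)"
      unfolding m_def by (intro measure_mono_fmeasurable meas fmeasurableD)
    then show "k / b * b \<le> measure lebesgue (ball x (3 * e) \<inter> E)"
      using k(2)[OF x'(1)] \<open>0 < b\<close> by simp
  qed
qed

lemma mixed_to_scale_nearby:
  assumes "mixed_to_scale E F e" "0 < e" "x \<in> F"
  obtains y where "y \<in> E" "norm (x - y) < e"
proof -
  obtain k where "0 < k" "k * measure lebesgue (ball x e) \<le> measure lebesgue (ball x e \<inter> E)"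
    using assms by (auto simp: mixed_to_scale_def)
  moreover have "0 < measure lebesgue (ball x e)" using \<open>0 < e\<close> by simp
  ultimately have "0 < measure lebesgue (ball x e \<inter> E)" by (meson mult_pos_pos order_less_le_trans)
  then have "ball x e \<inter> E \<noteq> {}" by auto
  then show thesis using that by (auto simp: dist_norm)
qed

text \<open>Rounding up the smaller end value gives an integer between the end values, as these
  differ by at least 1.\<close>

lemma continuous_attains_integer:
  fixes f :: "real \<Rightarrow> real"
  assumes "0 \<le> d" "continuous_on {0..d} f" "1 \<le> \<bar>f d - f 0\<bar>"
  obtains r n where "r \<in> {0..d}" "f r = of_int n"
proof (cases "f 0 \<le> f d")
  case True
  have "f 0 \<le> of_int \<lceil>f 0\<rceil>" "of_int \<lceil>f 0\<rceil> \<le> f d" using True assms(3) by linarith+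
  from IVT'[OF this assms(1,2)] show thesis using that by auto
next
  case False
  have "f d \<le> of_int \<lceil>f d\<rceil>" "of_int \<lceil>f d\<rceil> \<le> f 0" using False assms(3) by linarith+
  from IVT2'[OF this assms(1,2)] show thesis using that by auto
qed

section \<open>Lower and upper bounds for the mixing scale\<close>

context hamiltonian_flow
begin

lemma orbit_subset: "A \<subseteq> K \<Longrightarrow> orbit \<Phi> A \<subseteq> K"
  by (auto simp: orbit_def flow_in_K)

lemma mixing_scale_lower:
  assumes A: "A \<subseteq> K" "\<not> flow_invariant \<Phi> (closure A)"
    and per: "\<And>x. x \<in> A \<Longrightarrow> orbit_period \<Phi> x \<noteq> 0 \<and> orbit_period \<Phi> x \<noteq> \<infinity>"
  shows "\<exists>c>0. \<forall>t\<ge>0. \<forall>\<epsilon>>0. mixed_to_scale (\<Phi> t ` A) (orbit \<Phi> A) \<epsilon> \<longrightarrow> c / (1 + t) \<le> \<epsilon>"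
proof -
  have cl: "closure A \<subseteq> K" using A(1) compact_imp_closed[OF compact_K] by (rule closure_minimal)
  have "closure A \<subseteq> orbit \<Phi> (closure A)"
  proof
    fix x assume x: "x \<in> closure A"
    then have "x = \<Phi> 0 x" using cl by (auto simp: flow_0)
    then show "x \<in> orbit \<Phi> (closure A)" using x unfolding orbit_def by blast
  qed
  then obtain s where s: "\<not> \<Phi> s ` closure A \<subseteq> closure A"
    using A(2) by (auto simp: flow_invariant_def orbit_def)
  \<comment> \<open>By continuity, if \<Phi> s mapped A into the closure of A, it would also map the
    closure there. So the escaping point can be taken in A, and \<open>z\<close> lies in the orbit
    of A itself.\<close>
  then have "\<not> \<Phi> s ` A \<subseteq> closure A"
    using image_closure_subset[OF continuous_on_subset[OF continuous_flow cl] closed_closure] by blast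
  then obtain q where q: "q \<in> A" "\<Phi> s q \<notin> closure A" by blast
  define z where "z = \<Phi> s q"
  have qK: "q \<in> K" and z: "z \<in> K" using q A(1) by (auto simp: z_def flow_in_K)
  have "orbit_period \<Phi> z \<noteq> 0" "orbit_period \<Phi> z \<noteq> \<infinity>"
    using per[OF q(1)] qK by (simp_all add: z_def orbit_period_shift)
  then obtain T where T: "0 < T" "orbit_period \<Phi> z = ereal T" "\<Phi> T z = z"
    using orbit_period_cases[OF z] by blast
  obtain r where r: "0 < r" "\<And>a. a \<in> A \<Longrightarrow> r \<le> norm (a - z)"
    using q(2) unfolding z_def closure_approachable dist_norm by (auto simp: not_less)
  obtain c0 where c0: "0 < c0" "eventually (\<lambda>q. \<exists>T'>0. orbit_period \<Phi> q = ereal T' \<and> \<Phi> T' q = q \<and>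
      \<bar>T' - T\<bar> \<le> c0 * norm (q - z)) (near z)"
    using period_lipschitz_at[OF z T(2,1)] by blast
  then obtain \<rho> where \<rho>: "0 < \<rho>" "\<And>q. \<lbrakk>q \<in> K; norm (q - z) < \<rho>\<rbrakk> \<Longrightarrow>
      \<exists>T'>0. orbit_period \<Phi> q = ereal T' \<and> \<Phi> T' q = q \<and> \<bar>T' - T\<bar> \<le> c0 * norm (q - z)"
    unfolding eventually_near by blast
  define G where "G = growth T"
  have G: "1 \<le> G" by (simp add: G_def growth_ge_1)
  define B where "B = 1 + lip * c0 / T"
  have B: "1 \<le> B" using lip_pos c0 T by (simp add: B_def)
  \<comment> \<open>\<open>\<rho> / G\<close> places w where the comparison of periods holds;
    \<open>r / (G * B)\<close> yields the contradiction to |a - z| \<ge> r. G is the loss in undoing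
    a time of at most T, and B collects the drift rate and the offset |w - z|.\<close>
  define c where "c = min (\<rho> / G) (r / (G * B))"
  have c: "0 < c" using \<rho> G r B by (simp add: c_def)
  have "c / (1 + t) \<le> \<epsilon>" if t: "0 \<le> t" and \<epsilon>: "0 < \<epsilon>"
    and mixed: "mixed_to_scale (\<Phi> t ` A) (orbit \<Phi> A) \<epsilon>" for t \<epsilon>
  proof (rule ccontr)
    assume "\<not> c / (1 + t) \<le> \<epsilon>"
    then have less: "\<epsilon> * (1 + t) < c" using t by (simp add: not_le pos_less_divide_eq)
    define n where "n = \<lfloor>t / T\<rfloor>"
    \<comment> \<open>Going back by \<tau> already returns \<open>z\<close> to itself. As |\<tau>|
      \<le> T, the loss is bounded independently of t.\<close>
    define \<tau> where "\<tau> = t - of_int n * T"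
    have n: "0 \<le> (of_int n :: real)" "of_int n \<le> t / T" using t T by (auto simp: n_def)
    have "of_int n * T \<le> t" using n(2) T(1) by (simp add: pos_le_divide_eq)
    moreover have "t / T < of_int n + 1" unfolding n_def by linarith
    then have "t < (of_int n + 1) * T" using T(1) by (simp add: pos_divide_less_eq)
    ultimately have \<tau>: "\<bar>\<tau>\<bar> \<le> T" by (simp add: \<tau>_def algebra_simps)
    have "\<Phi> t z = \<Phi> (t + s) q" using qK by (simp add: z_def flow_add)
    then have "\<Phi> t z \<in> orbit \<Phi> A" using q(1) by (auto simp: orbit_def)
    then obtain y where "y \<in> \<Phi> t ` A" "norm (\<Phi> t z - y) < \<epsilon>"
      using mixed_to_scale_nearby[OF mixed \<epsilon>] by blast
    then obtain a where a: "a \<in> A" "norm (\<Phi> t z - \<Phi> t a) < \<epsilon>" by auto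
    have aK: "a \<in> K" using a A(1) by blast
    define w where "w = \<Phi> (of_int n * T) a"
    have wK: "w \<in> K" using aK by (simp add: w_def flow_in_K)
    have "\<Phi> (- \<tau>) (\<Phi> t a) = w" "\<Phi> (- \<tau>) (\<Phi> t z) = z"
      using aK z flow_periodic[OF z T(3), of n] by (simp_all add: w_def \<tau>_def flip: flow_add)
    then have "norm (w - z) \<le> growth (- \<tau>) * norm (\<Phi> t a - \<Phi> t z)"
      using flow_lipschitz[of "\<Phi> t a" "\<Phi> t z" "- \<tau>"] aK z by (simp add: flow_in_K)
    also have "\<dots> \<le> G * \<epsilon>"
      unfolding G_def using \<tau> T(1) a growth_ge_1[of T]
      by (intro mult_mono growth_mono) (auto simp: norm_minus_commute)
    finally have wz: "norm (w - z) \<le> G * \<epsilon>" .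
    have "\<epsilon> \<le> \<epsilon> * (1 + t)" using t \<epsilon> by simp
    then have "\<epsilon> < \<rho> / G" using less by (simp add: c_def)
    then have "norm (w - z) < \<rho>" using wz G by (simp add: pos_less_divide_eq mult.commute)
    then obtain T' where T': "\<Phi> T' w = w" "\<bar>T' - T\<bar> \<le> c0 * norm (w - z)" using \<rho>(2)[OF wK] by blast
    \<comment> \<open>w has period T', so n T' may be added to the time: what remains is the
      accumulated difference of periods over n turns.\<close>
    have "a = \<Phi> (of_int n * (- T)) w" using aK by (simp add: w_def flow_inverse)
    also have "\<dots> = \<Phi> (of_int n * (T' - T)) w"
      using wK flow_periodic[OF wK T'(1), of n]
        flow_add[OF wK, of "of_int n * (- T)" "of_int n * T'"]
      by (simp add: algebra_simps)
    finally have "norm (a - w) \<le> lip * \<bar>of_int n * (T' - T)\<bar>"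
      using flow_speed[OF wK, of "of_int n * (T' - T)" 0] wK by (simp add: flow_0)
    also have "\<dots> \<le> lip * (t / T * (c0 * norm (w - z)))"
      unfolding abs_mult using n T' lip_pos t T by (intro mult_left_mono mult_mono) auto
    also have "\<dots> = (lip * c0 / T) * t * norm (w - z)" by simp
    finally have aw: "norm (a - w) \<le> (lip * c0 / T) * t * norm (w - z)" .
    have "r \<le> norm (a - z)" by (rule r(2)[OF a(1)])
    also have "\<dots> \<le> norm (a - w) + norm (w - z)" using norm_triangle_ineq[of "a - w" "w - z"] by simp
    also have "\<dots> \<le> (B * (1 + t)) * norm (w - z)"
    proof -
      have "k * t + 1 \<le> (1 + k) * (1 + t)" if "0 \<le> k" for k
        using that t by (simp add: algebra_simps)
      from this[of "lip * c0 / T"] have "(lip * c0 / T) * t + 1 \<le> B * (1 + t)"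
        unfolding B_def using lip_pos c0(1) T(1) by (simp only: divide_nonneg_pos mult_nonneg_nonneg less_imp_le)
      then have "((lip * c0 / T) * t + 1) * norm (w - z) \<le> B * (1 + t) * norm (w - z)"
        by (rule mult_right_mono) simp
      then show ?thesis using aw by (simp add: algebra_simps)
    qed
    also have "\<dots> \<le> (B * (1 + t)) * (G * \<epsilon>)" using wz B t by (intro mult_left_mono) auto
    also have "\<dots> = (G * B) * (\<epsilon> * (1 + t))" by simp
    also have "\<dots> < (G * B) * (r / (G * B))"
      using less G B by (intro mult_strict_left_mono) (auto simp: c_def)
    finally show False using G B by simp
  qed
  then show ?thesis using c by blast
qed

text \<open>Near p the period is at most T(p) + 1, and compactness makes the bound uniform.\<close>

lemma period_bounded:
  assumes A: "compact A" "A \<subseteq> K"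
    and per: "\<And>x. x \<in> A \<Longrightarrow> orbit_period \<Phi> x \<noteq> 0 \<and> orbit_period \<Phi> x \<noteq> \<infinity>"
  obtains Tm where "0 < Tm" "\<And>x. x \<in> A \<Longrightarrow> \<exists>T>0. orbit_period \<Phi> x = ereal T \<and> \<Phi> T x = x \<and> T \<le> Tm"
proof -
  have "\<exists>k>0. \<forall>x\<in>A. x \<in> K \<longrightarrow> (\<exists>T>0. orbit_period \<Phi> x = ereal T \<and> \<Phi> T x = x \<and> T \<le> 1 / k)"
  proof (rule compact_uniform_constant[OF A(1)])
    fix x and k k' :: real
    assume "x \<in> K \<longrightarrow> (\<exists>T>0. orbit_period \<Phi> x = ereal T \<and> \<Phi> T x = x \<and> T \<le> 1 / k)" "0 < k'" "k' \<le> k"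
    moreover have "1 / k \<le> 1 / k'" using calculation by (intro divide_left_mono) auto
    ultimately show "x \<in> K \<longrightarrow> (\<exists>T>0. orbit_period \<Phi> x = ereal T \<and> \<Phi> T x = x \<and> T \<le> 1 / k')"
      by (meson order_trans)
  next
    fix p assume p: "p \<in> A"
    then have pK: "p \<in> K" using A by blast
    obtain T where T: "0 < T" "orbit_period \<Phi> p = ereal T"
      using orbit_period_cases[OF pK] per[OF p] by blast
    obtain c where c: "0 < c" "eventually (\<lambda>q. \<exists>T'>0. orbit_period \<Phi> q = ereal T' \<and> \<Phi> T' q = q \<and>
      \<bar>T' - T\<bar> \<le> c * norm (q - p)) (near p)"
      using period_lipschitz_at[OF pK T(2,1)] by blast
    have "eventually (\<lambda>q. \<exists>T'>0. orbit_period \<Phi> q = ereal T' \<and> \<Phi> T' q = q \<and> T' \<le> T + 1) (near p)"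
      using c(2) eventually_near_norm[OF zero_less_one, of c p]
    proof eventually_elim
      case (elim q)
      then show ?case by fastforce
    qed
    then obtain d where "0 < d" "\<forall>q\<in>K. norm (q - p) < d \<longrightarrow>
        (\<exists>T'>0. orbit_period \<Phi> q = ereal T' \<and> \<Phi> T' q = q \<and> T' \<le> 1 / (1 / (T + 1)))"
      unfolding eventually_near by auto
    then show "\<exists>k>0. \<exists>r>0. \<forall>x\<in>ball p r. x \<in> K \<longrightarrow>
        (\<exists>T>0. orbit_period \<Phi> x = ereal T \<and> \<Phi> T x = x \<and> T \<le> 1 / k)"
      using T(1) by (intro exI[of _ "1 / (T + 1)"] conjI exI[of _ d])
        (auto simp: dist_norm norm_minus_commute)
  qed
  then obtain k where k: "0 < k"
    "\<forall>x\<in>A. x \<in> K \<longrightarrow> (\<exists>T>0. orbit_period \<Phi> x = ereal T \<and> \<Phi> T x = x \<and> T \<le> 1 / k)"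
    by blast
  show thesis
  proof (rule that)
    show "0 < 1 / k" using k(1) by simp
    show "\<exists>T>0. orbit_period \<Phi> x = ereal T \<and> \<Phi> T x = x \<and> T \<le> 1 / k" if "x \<in> A" for x
      using k(2) that A(2) by blast
  qed
qed

text \<open>\<open>T\<close> is locally a function of \<open>H\<close>, so \<open>\<nabla>T\<close> is parallel to \<open>\<nabla>H\<close>. Hence on a segment
  along which \<open>H\<close> varies at a definite rate, so does \<open>T\<close>, by the mean value theorem; no
  continuity of \<open>\<nabla>T\<close> is required.\<close>
lemma period_varies:
  assumes A: "bounded_lipschitz_domain A" "A \<subseteq> interior K"
    and per: "\<And>x. x \<in> closure A \<Longrightarrow> orbit_period \<Phi> x \<noteq> 0 \<and> orbit_period \<Phi> x \<noteq> \<infinity>"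
    and g: "0 < g" "\<And>x. x \<in> A \<Longrightarrow> g \<le> norm (grad (\<lambda>y. real_of_ereal (orbit_period \<Phi> y)) x)"
  obtains h c E where "0 < h" "0 < c" "0 < E"
    "\<And>a. a \<in> A \<Longrightarrow> \<exists>e. norm e \<le> E \<and> (\<forall>r\<in>{0..h}. a + r *\<^sub>R e \<in> A) \<and>
      continuous_on {0..h} (\<lambda>r. real_of_ereal (orbit_period \<Phi> (a + r *\<^sub>R e))) \<and>
      (\<forall>d\<in>{0..h}. c * d \<le> \<bar>real_of_ereal (orbit_period \<Phi> (a + d *\<^sub>R e)) - real_of_ereal (orbit_period \<Phi> a)\<bar>)"
proof -
  define \<tau> where "\<tau> y = real_of_ereal (orbit_period \<Phi> y)" for y
  have AK: "A \<subseteq> K" using A(2) interior_subset by blast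
  have cl: "closure A \<subseteq> K" using AK compact_imp_closed[OF compact_K] by (rule closure_minimal)
  have "compact (closure A)" "closure A \<noteq> {}" using A(1) by (auto simp: bounded_lipschitz_domain_def)
  moreover have "continuous_on (closure A) (\<lambda>x. norm (W x))"
    by (intro continuous_intros continuous_W)
  ultimately have "\<exists>x\<in>closure A. \<forall>y\<in>closure A. norm (W x) \<le> norm (W y)"
    by (rule continuous_attains_inf)
  then obtain x0 where x0: "x0 \<in> closure A" "\<And>x. x \<in> closure A \<Longrightarrow> norm (W x0) \<le> norm (W x)"
    by blast
  \<comment> \<open>The closure of A contains no stationary point, so the least speed is
    positive.\<close>
  define w where "w = norm (W x0)"
  have "W x0 \<noteq> 0"
  proof -
    have "x0 \<in> K" using x0(1) cl by blast
    then show ?thesis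
      using per[OF x0(1)] by (auto elim: orbit_period_cases)
  qed
  then have w: "0 < w" "\<And>x. x \<in> A \<Longrightarrow> w \<le> norm (W x)"
    using x0(2) closure_subset by (auto simp: w_def)
  have deriv: "\<exists>b. g / lip \<le> \<bar>b\<bar> \<and> (\<tau> has_derivative (\<lambda>v. b * (rot90 (W x) \<bullet> v))) (at x)"
    if x: "x \<in> A" for x
  proof -
    have xK: "x \<in> K" and xc: "x \<in> closure A" and xi: "x \<in> interior K"
      using x AK A(2) closure_subset by auto
    obtain T where T: "0 < T" "orbit_period \<Phi> x = ereal T"
      using orbit_period_cases[OF xK] per[OF xc] by blast
    obtain b where b: "(\<tau> has_derivative (\<lambda>v. b * (rot90 (W x) \<bullet> v))) (at x)"
      using period_has_derivative[OF xi T(2,1)] unfolding \<tau>_def by blast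
    \<comment> \<open>The derivative is known here, so \<open>grad\<close> is the true gradient, and
      its lower bound becomes one for the factor b.\<close>
    have "grad \<tau> x = b *\<^sub>R rot90 (W x)"
      unfolding grad_def partial_deriv_def frechet_derivative_at[OF b, symmetric]
      by (simp add: vec_eq_iff inner_axis)
    then have "g \<le> \<bar>b\<bar> * norm (W x)" using g(2)[OF x] by (simp add: \<tau>_def[abs_def])
    also have "\<dots> \<le> \<bar>b\<bar> * lip" by (intro mult_left_mono norm_W xK) simp
    finally have "g / lip \<le> \<bar>b\<bar>" using lip_pos by (simp add: pos_divide_le_eq)
    with b show ?thesis by blast
  qed
  obtain h0 where h0: "0 < h0" "\<And>a n. a \<in> A \<Longrightarrow> \<exists>e. norm e \<le> 1 / h0 \<and> norm n \<le> \<bar>n \<bullet> e\<bar> \<and>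
    (\<forall>r\<in>{0..h0}. a + r *\<^sub>R e \<in> A)"
    using lipschitz_domain_transversal_segment[OF A(1)] by blast
  define E where "E = 1 / h0"
  \<comment> \<open>Along a segment of this parameter length the derivative of H in direction e
    changes by at most lip h E^2 \<le> w / 2. It is at least w in modulus at \<open>a\<close>, so it
    stays above w / 2.\<close>
  define h where "h = min h0 (w / (2 * lip * E * E))"
  define c where "c = g / lip * (w / 2)"
  have E: "0 < E" using h0 by (simp add: E_def)
  have h: "0 < h" "h \<le> h0" "h * (lip * E * E) \<le> w / 2"
  proof -
    show "0 < h" using h0 w lip_pos E by (simp add: h_def)
    show "h \<le> h0" by (simp add: h_def)
    have "h \<le> w / (2 * lip * E * E)" by (simp add: h_def)
    then have "h * (2 * lip * E * E) \<le> w" using lip_pos E by (simp add: pos_le_divide_eq)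
    then show "h * (lip * E * E) \<le> w / 2" by simp
  qed
  show thesis
  proof (rule that[of h c E])
    show "0 < h" "0 < E" by (fact h E)+
    show "0 < c" using g w lip_pos by (simp add: c_def)
    fix a assume a: "a \<in> A"
    define N where "N = rot90 (W a)"
    obtain e where e: "norm e \<le> E" "norm N \<le> \<bar>N \<bullet> e\<bar>" "\<And>r. r \<in> {0..h} \<Longrightarrow> a + r *\<^sub>R e \<in> A"
      using h0(2)[OF a, of N] h(2) unfolding E_def by force
    define \<phi> where "\<phi> r = \<tau> (a + r *\<^sub>R e)" for r
    have \<phi>': "\<exists>m. c \<le> \<bar>m\<bar> \<and> (\<phi> has_real_derivative m) (at r)" if r: "r \<in> {0..h}" for r
    proof -
      let ?x = "a + r *\<^sub>R e"
      have x: "?x \<in> A" using e(3) r .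
      obtain b where b: "g / lip \<le> \<bar>b\<bar>" "(\<tau> has_derivative (\<lambda>v. b * (rot90 (W ?x) \<bullet> v))) (at ?x)"
        using deriv[OF x] by blast
      have "(\<phi> has_derivative (\<lambda>s. b * (rot90 (W ?x) \<bullet> (s *\<^sub>R e)))) (at r)"
        unfolding \<phi>_def by (rule has_derivative_compose[where f = "\<lambda>s. a + s *\<^sub>R e", OF _ b(2)]) (auto intro!: derivative_eq_intros)
      then have "(\<phi> has_real_derivative b * (rot90 (W ?x) \<bullet> e)) (at r)"
        by (simp add: has_field_derivative_def mult_commute_abs algebra_simps)
      moreover have "c \<le> \<bar>b * (rot90 (W ?x) \<bullet> e)\<bar>"
      proof -
        have "norm (W ?x - W a) \<le> lip * norm (?x - a)"
          using x a AK by (intro W_lipschitz) auto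
        also have "\<dots> \<le> lip * (h * E)"
          using r e(1) E h(1) lip_pos by (simp add: mult_mono)
        finally have "norm (rot90 (W ?x) - N) \<le> lip * (h * E)" by (simp add: N_def rot90_diff)
        then have "norm (rot90 (W ?x) - N) * norm e \<le> lip * (h * E) * E"
          using e(1) lip_pos h(1) E by (intro mult_mono) auto
        then have "\<bar>(rot90 (W ?x) - N) \<bullet> e\<bar> \<le> w / 2"
          using Cauchy_Schwarz_ineq2[of "rot90 (W ?x) - N" e] h(3) by (simp add: algebra_simps)
        moreover have "w \<le> \<bar>N \<bullet> e\<bar>" using w(2)[OF a] e(2) by (simp add: N_def)
        ultimately have "w / 2 \<le> \<bar>rot90 (W ?x) \<bullet> e\<bar>" unfolding inner_diff_left by linarith
        then show ?thesis
          unfolding c_def abs_mult using b(1) g lip_pos w by (intro mult_mono) auto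
      qed
      ultimately show ?thesis by blast
    qed
    have "c * d \<le> \<bar>\<phi> d - \<phi> 0\<bar>" if d: "d \<in> {0..h}" for d
    proof (cases "d = 0")
      case False
      obtain m where m: "\<And>r. r \<in> {0..h} \<Longrightarrow> c \<le> \<bar>m r\<bar> \<and> (\<phi> has_real_derivative m r) (at r)"
        using \<phi>' by metis
      have "0 < d" "\<And>r. \<lbrakk>0 \<le> r; r \<le> d\<rbrakk> \<Longrightarrow> (\<phi> has_real_derivative m r) (at r)"
        using m d False by auto
      from MVT2[OF this] obtain r where r: "0 < r" "r < d" "\<phi> d - \<phi> 0 = (d - 0) * m r" by blast
      have "c * d \<le> \<bar>m r\<bar> * d" using m[of r] r d by (intro mult_right_mono) auto
      then show ?thesis using r d by (simp add: abs_mult mult.commute)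
    qed simp
    moreover have "continuous_on {0..h} \<phi>"
      using \<phi>' DERIV_isCont by (intro continuous_at_imp_continuous_on) blast
    ultimately show "\<exists>e. norm e \<le> E \<and> (\<forall>r\<in>{0..h}. a + r *\<^sub>R e \<in> A) \<and>
      continuous_on {0..h} (\<lambda>r. real_of_ereal (orbit_period \<Phi> (a + r *\<^sub>R e))) \<and>
      (\<forall>d\<in>{0..h}. c * d \<le> \<bar>real_of_ereal (orbit_period \<Phi> (a + d *\<^sub>R e)) - real_of_ereal (orbit_period \<Phi> a)\<bar>)"
      using e by (intro exI[of _ e]) (auto simp: \<phi>_def \<tau>_def)
  qed
qed

text \<open>To approximate \<open>\<Phi> s a\<close> at time \<open>t\<close>, move \<open>a\<close> by \<open>O(1/t)\<close> inside \<open>A\<close> to a point whose period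
  divides \<open>t - s\<close>.\<close>
lemma dense_after_time:
  assumes A: "bounded_lipschitz_domain A" "A \<subseteq> interior K"
    and per: "\<And>x. x \<in> closure A \<Longrightarrow> orbit_period \<Phi> x \<noteq> 0 \<and> orbit_period \<Phi> x \<noteq> \<infinity>"
    and g: "0 < g" "\<And>x. x \<in> A \<Longrightarrow> g \<le> norm (grad (\<lambda>y. real_of_ereal (orbit_period \<Phi> y)) x)"
  shows "\<exists>C>0. \<forall>t\<ge>0. \<forall>x\<in>orbit \<Phi> A. \<exists>y\<in>\<Phi> t ` A. norm (x - y) \<le> C / (1 + t)"
proof -
  have AK: "A \<subseteq> K" using A(2) interior_subset by blast
  have cl: "closure A \<subseteq> K" using AK compact_imp_closed[OF compact_K] by (rule closure_minimal)
  have "compact (closure A)" "A \<noteq> {}" using A(1) by (auto simp: bounded_lipschitz_domain_def)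
  obtain Tm where Tm0: "0 < Tm"
    "\<And>x. x \<in> closure A \<Longrightarrow> \<exists>T>0. orbit_period \<Phi> x = ereal T \<and> \<Phi> T x = x \<and> T \<le> Tm"
    using period_bounded[OF \<open>compact (closure A)\<close> cl per] by blast
  note Tm = Tm0(1) Tm0(2)[OF subsetD[OF closure_subset]]
  obtain h c E where h: "0 < h" and c: "0 < c" and E: "0 < E" and seg:
    "\<And>a. a \<in> A \<Longrightarrow> \<exists>e. norm e \<le> E \<and> (\<forall>r\<in>{0..h}. a + r *\<^sub>R e \<in> A) \<and>
      continuous_on {0..h} (\<lambda>r. real_of_ereal (orbit_period \<Phi> (a + r *\<^sub>R e))) \<and>
      (\<forall>d\<in>{0..h}. c * d \<le> \<bar>real_of_ereal (orbit_period \<Phi> (a + d *\<^sub>R e)) - real_of_ereal (orbit_period \<Phi> a)\<bar>)"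
    using period_varies[OF A per g] by blast
  obtain R where R: "\<And>x. x \<in> K \<Longrightarrow> norm x \<le> R"
    using compact_imp_bounded[OF compact_K] by (auto simp: bounded_iff)
  \<comment> \<open>For t \<ge> t0: 1 + t \<le> 2t; t - s \<ge> t / 2, as s \<le> Tm; and the length
    d chosen below fits into the segment.\<close>
  define t0 where "t0 = max 1 (max (2 * Tm) (2 * Tm\<^sup>2 / (c * h)))"
  define M where "M = growth Tm * (E * (2 * Tm\<^sup>2 / c))"
  \<comment> \<open>The first term covers t < t0, when any two points of K are close enough; the
    second turns M / t into C / (1 + t).\<close>
  define C where "C = max (2 * \<bar>R\<bar> * (1 + t0)) (2 * M) + 1"
  have M: "0 \<le> M" using growth_ge_1[of Tm] E c by (simp add: M_def)
  have C: "0 < C" "2 * \<bar>R\<bar> * (1 + t0) \<le> C" "2 * M \<le> C" using M by (auto simp: C_def)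
  have "\<exists>y\<in>\<Phi> t ` A. norm (x - y) \<le> C / (1 + t)" if t: "0 \<le> t" and x: "x \<in> orbit \<Phi> A" for t x
  proof (cases "t < t0")
    case True
    obtain a where "a \<in> A" using \<open>A \<noteq> {}\<close> by blast
    then have "norm x \<le> R" "norm (\<Phi> t a) \<le> R"
      using R AK x orbit_subset[OF AK] flow_in_K by blast+
    then have "norm (x - \<Phi> t a) \<le> 2 * \<bar>R\<bar>" using norm_triangle_ineq4[of x "\<Phi> t a"] by simp
    also have "\<dots> \<le> C / (1 + t)"
    proof -
      have "2 * \<bar>R\<bar> * (1 + t) \<le> 2 * \<bar>R\<bar> * (1 + t0)" using True by (intro mult_left_mono) auto
      then show ?thesis using C(2) t by (simp add: pos_le_divide_eq)
    qed
    finally show ?thesis using \<open>a \<in> A\<close> by blast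
  next
    case False
    then have t0: "1 \<le> t" "2 * Tm \<le> t" "2 * Tm\<^sup>2 / (c * h) \<le> t" by (auto simp: t0_def)
    obtain a s0 where a: "a \<in> A" "x = \<Phi> s0 a" using x by (auto simp: orbit_def)
    have aK: "a \<in> K" using a AK by blast
    obtain T where T: "0 < T" "orbit_period \<Phi> a = ereal T" "\<Phi> T a = a" "T \<le> Tm"
      using Tm(2)[OF a(1)] by blast
    define s where "s = s0 - of_int \<lfloor>s0 / T\<rfloor> * T"
    have "of_int \<lfloor>s0 / T\<rfloor> * T \<le> s0 / T * T"
      using T(1) by (intro mult_right_mono) auto
    moreover have "s0 / T * T < (of_int \<lfloor>s0 / T\<rfloor> + 1) * T"
      using T(1) by (intro mult_strict_right_mono) linarith+
    ultimately have s: "0 \<le> s" "s \<le> Tm"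
      using T(1,4) by (simp_all add: s_def algebra_simps)
    have "\<Phi> s0 a = \<Phi> (s + of_int \<lfloor>s0 / T\<rfloor> * T) a" by (simp add: s_def)
    also have "\<dots> = \<Phi> s a" unfolding flow_add[OF aK] flow_periodic[OF aK T(3)] ..
    finally have xs: "x = \<Phi> s a" using a(2) by simp
    obtain e where e: "norm e \<le> E" "\<And>r. r \<in> {0..h} \<Longrightarrow> a + r *\<^sub>R e \<in> A"
      and cont: "continuous_on {0..h} (\<lambda>r. real_of_ereal (orbit_period \<Phi> (a + r *\<^sub>R e)))"
      and var: "\<And>d. d \<in> {0..h} \<Longrightarrow>
        c * d \<le> \<bar>real_of_ereal (orbit_period \<Phi> (a + d *\<^sub>R e)) - real_of_ereal (orbit_period \<Phi> a)\<bar>"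
      using seg[OF a(1)] by blast
    define \<phi> where "\<phi> r = real_of_ereal (orbit_period \<Phi> (a + r *\<^sub>R e))" for r
    \<comment> \<open>Chosen so that (t / 2) c d = Tm^2, which bounds the product of two periods; so
      the number of turns changes by at least 1.\<close>
    define d where "d = 2 * Tm\<^sup>2 / (c * t)"
    have d: "0 < d" using Tm(1) c t0 by (simp add: d_def)
    have "d \<le> h"
    proof -
      have "2 * Tm\<^sup>2 \<le> t * (c * h)" using t0(3) c h by (simp add: pos_divide_le_eq)
      then show ?thesis using c t0(1) by (simp add: d_def pos_divide_le_eq algebra_simps)
    qed
    have \<phi>: "0 < \<phi> r" "\<phi> r \<le> Tm" "\<Phi> (\<phi> r) (a + r *\<^sub>R e) = a + r *\<^sub>R e" if "r \<in> {0..h}" for r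
      using Tm(2)[OF e(2)[OF that]] by (auto simp: \<phi>_def)
    \<comment> \<open>The number of turns made in time t - s. Where it is an integer, the positions
      at times t and s agree.\<close>
    define \<psi> where "\<psi> r = (t - s) / \<phi> r" for r
    have "continuous_on {0..d} \<psi>"
      unfolding \<psi>_def using cont \<open>d \<le> h\<close> \<phi>(1)
      by (intro continuous_intros) (force simp: \<phi>_def intro: continuous_on_subset)+
    moreover have "1 \<le> \<bar>\<psi> d - \<psi> 0\<bar>"
    proof -
      have r: "d \<in> {0..h}" "0 \<in> {0..h}" using d \<open>d \<le> h\<close> h by auto
      have pos: "0 < \<phi> d" "0 < \<phi> 0" using r by (auto intro: \<phi>)
      have "\<phi> d * \<phi> 0 \<le> Tm * Tm" using pos r Tm(1) by (intro mult_mono \<phi>) auto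
      also have "\<dots> = t / 2 * (c * d)" using c t0(1) by (simp add: d_def power2_eq_square)
      also have "\<dots> \<le> (t - s) * \<bar>\<phi> d - \<phi> 0\<bar>"
        using var[OF r(1)] s t0 c d by (intro mult_mono) (auto simp: \<phi>_def)
      finally have "1 \<le> (t - s) * \<bar>\<phi> d - \<phi> 0\<bar> / (\<phi> d * \<phi> 0)" using pos by (simp add: pos_le_divide_eq)
      also have "\<dots> = \<bar>\<psi> d - \<psi> 0\<bar>"
      proof -
        have "\<psi> d - \<psi> 0 = (t - s) * (\<phi> 0 - \<phi> d) / (\<phi> d * \<phi> 0)"
          using pos by (simp add: \<psi>_def divide_simps) (simp add: algebra_simps)
        then show ?thesis using pos s t0 by (simp add: abs_mult abs_minus_commute)
      qed
      finally show ?thesis .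
    qed
    ultimately obtain r n where r: "r \<in> {0..d}" "\<psi> r = of_int n"
      using continuous_attains_integer[of d \<psi>] d by auto
    define b where "b = a + r *\<^sub>R e"
    have rh: "r \<in> {0..h}" using r(1) \<open>d \<le> h\<close> by auto
    then have b: "b \<in> A" "b \<in> K" using e(2) AK by (auto simp: b_def)
    have "t = s + of_int n * \<phi> r"
      using r(2) \<phi>(1)[OF rh] by (simp add: \<psi>_def field_simps)
    then have "\<Phi> t b = \<Phi> s (\<Phi> (of_int n * \<phi> r) b)" using flow_add[OF b(2)] by simp
    also have "\<dots> = \<Phi> s b" using flow_periodic[OF b(2)] \<phi>(3)[OF rh] by (simp add: b_def)
    finally have "norm (x - \<Phi> t b) \<le> growth s * norm (a - b)"
      using flow_lipschitz[OF aK b(2), of s] xs by simp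
    also have "\<dots> \<le> growth Tm * (d * E)"
      using s r(1) e(1) E d growth_ge_1[of Tm]
      by (intro mult_mono growth_mono) (auto simp: b_def mult_mono)
    also have "\<dots> = M / t" using c t0(1) by (simp add: M_def d_def)
    also have "\<dots> \<le> C / (1 + t)"
    proof -
      have "M * (1 + t) \<le> M * (2 * t)" using M t0(1) by (intro mult_left_mono) auto
      also have "\<dots> \<le> C * t" using C(3) t0(1) by (simp add: mult_right_mono)
      finally show ?thesis using t0(1) by (simp add: frac_le_eq divide_simps)
    qed
    finally show ?thesis using b(1) by blast
  qed
  then show ?thesis using C(1) by blast
qed

text \<open>Density becomes positive measure because the image of A under \<open>\<Phi> t\<close> is
  open, by invariance of domain.\<close>

lemma mixing_scale_upper:
  assumes A: "bounded_lipschitz_domain A" "A \<subseteq> interior K"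
    and per: "\<And>x. x \<in> closure A \<Longrightarrow> orbit_period \<Phi> x \<noteq> 0 \<and> orbit_period \<Phi> x \<noteq> \<infinity>"
    and g: "0 < g" "\<And>x. x \<in> A \<Longrightarrow> g \<le> norm (grad (\<lambda>y. real_of_ereal (orbit_period \<Phi> y)) x)"
  shows "\<exists>C>0. \<forall>t\<ge>0. mixed_to_scale (\<Phi> t ` A) (orbit \<Phi> A) (C / (1 + t))"
proof -
  have AK: "A \<subseteq> K" using A(2) interior_subset by blast
  obtain C where C: "0 < C" "\<And>t x. \<lbrakk>0 \<le> t; x \<in> orbit \<Phi> A\<rbrakk> \<Longrightarrow> \<exists>y\<in>\<Phi> t ` A. norm (x - y) \<le> C / (1 + t)"
    using dense_after_time[OF A per g] by blast
  have "mixed_to_scale (\<Phi> t ` A) (orbit \<Phi> A) (3 * C / (1 + t))" if t: "0 \<le> t" for t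
  proof -
    have "mixed_to_scale (\<Phi> t ` A) (orbit \<Phi> A) (3 * (C / (1 + t)))"
    proof (rule mixed_to_scale_of_dense)
      have "inj_on (\<Phi> t) A" using AK flow_inverse(1) by (metis inj_on_inverseI subset_iff)
      then show "open (\<Phi> t ` A)"
        using A(1) continuous_on_subset[OF continuous_flow AK]
        by (intro invariance_of_domain) (auto simp: bounded_lipschitz_domain_def)
      show "bounded (orbit \<Phi> A)"
        using orbit_subset[OF AK] compact_imp_bounded[OF compact_K] bounded_subset by blast
    qed (use C t in auto)
    then show ?thesis by simp
  qed
  then show ?thesis using C(1) by (intro exI[of _ "3 * C"]) auto
qed

end

section \<open>From the stream function to the theorem\<close>

text \<open>H determines V on the closure of \<Omega> only; its Hamiltonian field \<open>W\<close>
  on the whole plane extends V, and the flow sees no difference.\<close>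

lemma hamiltonian_flow_of_stream_function:
  assumes "bounded \<Omega>" "stream_function \<Omega> V H" "is_flow V (closure \<Omega>) \<Phi>"
  obtains W DW where "hamiltonian_flow (closure \<Omega>) H W DW \<Phi>"
proof -
  obtain H' H'' where H: "C2_with H H' H''" and
    V: "\<And>x. x \<in> closure \<Omega> \<Longrightarrow> V x = vector [partial_deriv 2 H x, - partial_deriv 1 H x]"
    using assms(2) unfolding stream_function_def C2_def by blast
  have H': "(H has_derivative blinfun_apply (H' x)) (at x)"
    and H'': "(H' has_derivative blinfun_apply (H'' x)) (at x)" "continuous_on UNIV H''" for x
    using H unfolding C2_with_def by blast+
  have pd: "partial_deriv i H x = H' x (axis i 1)" for i x
    unfolding partial_deriv_def frechet_derivative_at[OF H', symmetric] ..
  \<comment> \<open>The linear map from the differential of H to its Hamiltonian field, so that the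
    derivative of \<open>W\<close> is j composed with the second derivative.\<close>
  define j where "j f = f (axis 2 1) *\<^sub>R axis 1 1 - f (axis 1 1) *\<^sub>R (axis 2 1 :: real^2)"
    for f :: "(real^2) \<Rightarrow>\<^sub>L real"
  have j_nth: "j f $ 1 = f (axis 2 1)" "j f $ 2 = - f (axis 1 1)" for f :: "(real^2) \<Rightarrow>\<^sub>L real"
    by (simp_all add: j_def axis_def)
  have "bounded_linear (\<lambda>f :: (real^2) \<Rightarrow>\<^sub>L real. f v *\<^sub>R u)" for u v :: "real^2"
    by (intro bounded_linear_compose[OF bounded_linear_scaleR_left] blinfun.bounded_linear_left)
  then have "bounded_linear j"
    unfolding j_def by (intro bounded_linear_sub)
  then have J: "blinfun_apply (Blinfun j) = j" by (rule bounded_linear_Blinfun_apply)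
  define W where "W x = j (H' x)" for x
  have "hamiltonian_flow (closure \<Omega>) H W (\<lambda>x. Blinfun j o\<^sub>L H'' x) \<Phi>"
  proof
    show "compact (closure \<Omega>)" using assms(1) by simp
    show "(W has_derivative blinfun_apply (Blinfun j o\<^sub>L H'' x)) (at x)" for x
      using has_derivative_compose[OF H''(1) bounded_linear_imp_has_derivative[OF \<open>bounded_linear j\<close>]]
      by (simp add: W_def[abs_def] J blinfun_compose.rep_eq comp_def)
    show "continuous_on UNIV (\<lambda>x. Blinfun j o\<^sub>L H'' x)"
      by (intro bounded_bilinear.continuous_on[OF bounded_bilinear_blinfun_compose] continuous_intros H'')
    show "(H has_derivative (\<lambda>v. rot90 (W x) \<bullet> v)) (at x)" for x
    proof -
      have "H' x v = rot90 (W x) \<bullet> v" for v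
      proof -
        have "v = v $ 1 *\<^sub>R axis 1 1 + v $ 2 *\<^sub>R axis 2 1"
          by (simp add: vec_eq_iff forall_2 axis_def)
        then have "H' x v = H' x (v $ 1 *\<^sub>R axis 1 1 + v $ 2 *\<^sub>R axis 2 1)" by (rule arg_cong)
        also have "\<dots> = v $ 1 * H' x (axis 1 1) + v $ 2 * H' x (axis 2 1)"
          by (simp add: blinfun.add_right blinfun.scaleR_right)
        finally have "H' x v = v $ 1 * H' x (axis 1 1) + v $ 2 * H' x (axis 2 1)" .
        then show ?thesis by (simp add: inner_2 rot90_def W_def j_nth mult.commute)
      qed
      then have "blinfun_apply (H' x) = (\<lambda>v. rot90 (W x) \<bullet> v)" by (rule ext)
      then show ?thesis using H'[of x] by simp
    qed
    have "V x = W x" if "x \<in> closure \<Omega>" for x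
      using V[OF that] by (simp add: vec_eq_iff forall_2 W_def j_nth pd)
    then show "is_flow W (closure \<Omega>) \<Phi>" using assms(3) unfolding is_flow_def by metis
  qed
  then show thesis using that by blast
qed

text \<open>The distance may be infinite, so a real e strictly below it is chosen; a point of A
  within e of \<open>x\<close> then contradicts \<open>x \<in> B\<close>.\<close>

lemma closure_disjoint_if_set_distance_pos:
  assumes "0 < set_distance A B" "x \<in> closure A"
  shows "x \<notin> B"
proof
  assume x: "x \<in> B"
  obtain e where e: "0 < ereal e" "ereal e < set_distance A B"
    using ereal_dense2[OF assms(1)] by blast
  then obtain a where "a \<in> A" "dist a x < e"
    using assms(2) by (auto simp: closure_approachable)
  then have "set_distance A B \<le> ereal (dist a x)"
    unfolding set_distance_def using x by (meson INF_lower2 order_refl)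
  also have "\<dots> < ereal e" using \<open>dist a x < e\<close> by simp
  finally show False using e by simp
qed

theorem theorem1p5:
  fixes \<Omega> A :: "(real^2) set"
    and V :: "real^2 \<Rightarrow> real^2"
    and H :: "real^2 \<Rightarrow> real"
    and \<Phi> :: "real \<Rightarrow> real^2 \<Rightarrow> real^2"
  assumes "bounded_lipschitz_domain \<Omega>"
    and "admissible_field \<Omega> V"
    and A1: "stream_function \<Omega> V H"
    and A2: "homogeneous_critical_points \<Omega> H"
    and "is_flow V (closure \<Omega>) \<Phi>"
    and "bounded_lipschitz_domain A" and "A \<subseteq> \<Omega>"
    and "\<not> flow_invariant \<Phi> (closure A)"
    and "set_distance A (degenerate_period_set \<Omega> \<Phi>) > 0"
    and "(INF x\<in>A. norm (grad (\<lambda>y. real_of_ereal (orbit_period \<Phi> y)) x)) > 0"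
  shows "\<exists>C1>0. \<exists>C2>0. \<forall>t\<ge>0.
           ereal (C1 / (1 + t)) \<le> mixing_scale \<Phi> t A \<and>
           mixing_scale \<Phi> t A \<le> ereal (C2 / (1 + t))"
proof -
  have \<Omega>: "bounded \<Omega>" "open \<Omega>"
    using \<open>bounded_lipschitz_domain \<Omega>\<close> by (auto simp: bounded_lipschitz_domain_def)
  obtain W DW where "hamiltonian_flow (closure \<Omega>) H W DW \<Phi>"
    using hamiltonian_flow_of_stream_function[OF \<Omega>(1) A1 \<open>is_flow V (closure \<Omega>) \<Phi>\<close>] by blast
  then interpret hamiltonian_flow "closure \<Omega>" H W DW \<Phi> .
  have "closure A \<subseteq> closure \<Omega>" using \<open>A \<subseteq> \<Omega>\<close> by (rule closure_mono)
  then have per: "orbit_period \<Phi> x \<noteq> 0 \<and> orbit_period \<Phi> x \<noteq> \<infinity>" if "x \<in> closure A" for x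
    using closure_disjoint_if_set_distance_pos[OF \<open>set_distance A _ > 0\<close> that] that
    by (auto simp: degenerate_period_set_def)
  let ?g = "INF x\<in>A. norm (grad (\<lambda>y. real_of_ereal (orbit_period \<Phi> y)) x)"
  have g: "?g \<le> norm (grad (\<lambda>y. real_of_ereal (orbit_period \<Phi> y)) x)" if "x \<in> A" for x
    using that by (intro cINF_lower bdd_belowI2[of _ 0]) auto
  have AK: "A \<subseteq> closure \<Omega>" using \<open>A \<subseteq> \<Omega>\<close> closure_subset by blast
  \<comment> \<open>T is differentiated at the points of A, so these must be interior to the set
    carrying the flow.\<close>
  have Ai: "A \<subseteq> interior (closure \<Omega>)"
    using \<open>A \<subseteq> \<Omega>\<close> interior_maximal[OF closure_subset \<Omega>(2)] by blast
  have "\<exists>c>0. \<forall>t\<ge>0. \<forall>\<epsilon>>0. mixed_to_scale (\<Phi> t ` A) (orbit \<Phi> A) \<epsilon> \<longrightarrow> c / (1 + t) \<le> \<epsilon>"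
    using per closure_subset by (intro mixing_scale_lower AK \<open>\<not> flow_invariant \<Phi> (closure A)\<close>) blast
  then obtain c where c: "0 < c"
    "\<And>t \<epsilon>. \<lbrakk>0 \<le> t; 0 < \<epsilon>; mixed_to_scale (\<Phi> t ` A) (orbit \<Phi> A) \<epsilon>\<rbrakk> \<Longrightarrow> c / (1 + t) \<le> \<epsilon>"
    by blast
  obtain C where C: "0 < C" "\<And>t. 0 \<le> t \<Longrightarrow> mixed_to_scale (\<Phi> t ` A) (orbit \<Phi> A) (C / (1 + t))"
    using mixing_scale_upper[OF \<open>bounded_lipschitz_domain A\<close> Ai per \<open>?g > 0\<close> g] by blast
  have "ereal (c / (1 + t)) \<le> mixing_scale \<Phi> t A \<and> mixing_scale \<Phi> t A \<le> ereal (C / (1 + t))"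
    if t: "0 \<le> t" for t
  proof
    show "ereal (c / (1 + t)) \<le> mixing_scale \<Phi> t A"
      unfolding mixing_scale_def using c(2)[OF t] by (intro Inf_greatest) auto
    show "mixing_scale \<Phi> t A \<le> ereal (C / (1 + t))"
      unfolding mixing_scale_def using C(2)[OF t] C(1) t by (intro Inf_lower) auto
  qed
  then show ?thesis using c(1) C(1) by blast
qed

end
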